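(* Let $N\ge 1$, $0<\theta\le 2$ and $p>1$. Let $u$ be a solution of $\partial_t u+(-\Delta)^{\theta/2}u=u^p$ in $\mathbf{R}^N\times(0,T)$ (in the sense of the context), where $0<T<\infty$. Let $\mu$ be a Radon measure in $\mathbf{R}^N$ satisfying $$\operatorname*{ess\,lim}_{t\to+0}\int_{\mathbf{R}^N}u(y,t)\phi(y)\,dy=\int_{\mathbf{R}^N}\phi(y)\,d\mu(y)$$ for all $\phi\in C_0(\mathbf{R}^N)$. Then $u$ is a solution of the Cauchy problem $\partial_t u+(-\Delta)^{\theta/2}u=u^p$, $u(0)=\mu$, in $\mathbf{R}^N\times[0,T)$ (in the sense of the context).
   Context: $C_0(\mathbf{R}^N)$ denotes the continuous functions with compact support. Radon measures are nonnegative. $\operatorname{ess\,lim}_{t\to+0}$ is the limit as $t\to+0$ after discarding a set of times $t$ of Lebesgue measure zero. $G=G(x,t)$ denotes the fundamental solution of $\partial_t u+(-\Delta)^{\theta/2}u=0$ in $\mathbf{R}^N\times(0,\infty)$, i.e. the positive smooth kernel with $\int_{\mathbf{R}^N}G(x,t)e^{-i\xi\cdot x}\,dx=e^{-t|\xi|^\theta}$ (the Gauss kernel $(4\pi t)^{-N/2}e^{-|x|^2/4t}$ when $\theta=2$). Let $u$ be a nonnegative measurable function in $\mathbf{R}^N\times(0,T)$, $0<T\le\infty$. (i) $u$ is a solution of $\partial_t u+(-\Delta)^{\theta/2}u=u^p$ in $\mathbf{R}^N\times(0,T)$ if $$\infty>u(x,t)=\int_{\mathbf{R}^N}G(x-y,t-\tau)u(y,\tau)\,dy+\int_\tau^t\int_{\mathbf{R}^N}G(x-y,t-s)u(y,s)^p\,dy\,ds$$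 for almost all $x\in\mathbf{R}^N$ and $0<\tau<t<T$. (ii) For a Radon measure $\mu$ in $\mathbf{R}^N$, $u$ is a solution of the Cauchy problem $\partial_t u+(-\Delta)^{\theta/2}u=u^p$, $u(0)=\mu$, in $\mathbf{R}^N\times[0,T)$ if $$\infty>u(x,t)=\int_{\mathbf{R}^N}G(x-y,t)\,d\mu(y)+\int_0^t\int_{\mathbf{R}^N}G(x-y,t-s)u(y,s)^p\,dy\,ds$$ for almost all $x\in\mathbf{R}^N$ and $0<t<T$. *)

theory Defs
  imports "HOL-Analysis.Analysis"
begin

text \<open>
  \<open>\<real>\<^sup>N\<close> is an arbitrary type \<open>'a :: euclidean_space\<close> (so \<open>N = DIM('a) \<ge> 1\<close>).
  A nonnegative function \<open>u\<close> on space-time has values in \<^typ>\<open>ennreal\<close>; that it is finite almost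
  everywhere is part of the notion of solution.
\<close>

primrec Ck_on :: "nat \<Rightarrow> 'a::euclidean_space set \<Rightarrow> ('a \<Rightarrow> real) \<Rightarrow> bool" where
  "Ck_on 0 S f \<longleftrightarrow> continuous_on S f"
| "Ck_on (Suc k) S f \<longleftrightarrow>
     (\<forall>x\<in>S. f differentiable (at x)) \<and>
     (\<forall>v\<in>Basis. Ck_on k S (\<lambda>x. frechet_derivative f (at x) v))"

text \<open>Meant for open \<open>S\<close> only, since the derivatives are taken in the whole space.\<close>

definition smooth_on :: "'a::euclidean_space set \<Rightarrow> ('a \<Rightarrow> real) \<Rightarrow> bool" where
  "smooth_on S f \<longleftrightarrow> (\<forall>k. Ck_on k S f)"

text \<open>
  The fundamental solution of \<open>\<partial>\<^sub>t u + (-\<Delta>)\<^bsup>\<theta>/2\<^esup> u = 0\<close>: the positive smooth kernel with spatial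
  Fourier transform \<open>exp (-t |\<xi>|\<^sup>\<theta>)\<close>. Integrability of \<open>G(\<cdot>,t)\<close> need not be required: the Bochner
  integral of a non-integrable function is 0, while the prescribed transform never vanishes.
  Values of \<open>G\<close> at \<open>t \<le> 0\<close> are irrelevant.
\<close>

definition fundamental_solution :: "real \<Rightarrow> ('a::euclidean_space \<Rightarrow> real \<Rightarrow> real) \<Rightarrow> bool" where
  "fundamental_solution \<theta> G \<longleftrightarrow>
     (\<forall>x. \<forall>t>0. G x t > 0) \<and>
     smooth_on (UNIV \<times> {0<..}) (\<lambda>(x, t). G x t) \<and>
     (\<forall>t>0. \<forall>\<xi>.
        (\<integral>x. complex_of_real (G x t) * exp (- (\<i> * complex_of_real (\<xi> \<bullet> x))) \<partial>lebesgue) =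
        complex_of_real (exp (- t * norm \<xi> powr \<theta>)))"

definition ennpowr :: "ennreal \<Rightarrow> real \<Rightarrow> ennreal" where
  "ennpowr a p = (if a = \<infinity> then \<infinity> else ennreal (enn2real a powr p))"

text \<open>Lebesgue measurability on \<open>\<real>\<^sup>N \<times> (0,T)\<close>.\<close>

definition measurable_upto :: "real \<Rightarrow> ('a::euclidean_space \<Rightarrow> real \<Rightarrow> ennreal) \<Rightarrow> bool" where
  "measurable_upto T u \<longleftrightarrow>
     (\<lambda>(x, t). u x t) \<in> borel_measurable (lebesgue_on (UNIV \<times> {0<..<T}))"

definition duhamel ::
  "('a::euclidean_space \<Rightarrow> real \<Rightarrow> real) \<Rightarrow> real \<Rightarrow> ('a \<Rightarrow> real \<Rightarrow> ennreal) \<Rightarrow>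
     real \<Rightarrow> 'a \<Rightarrow> real \<Rightarrow> ennreal" where
  "duhamel G p u \<tau> x t =
     (\<integral>\<^sup>+s\<in>{\<tau><..<t}.
        (\<integral>\<^sup>+y. ennreal (G (x - y) (t - s)) * ennpowr (u y s) p \<partial>lebesgue) \<partial>lebesgue)"

text \<open>
  ``For almost all \<open>x\<close> and \<open>0 < \<tau> < t < T\<close>'' is read as: for almost all \<open>(x, \<tau>, t)\<close> with
  respect to Lebesgue measure, \<open>u\<close> being determined only up to null sets.
\<close>

definition is_solution ::
  "('a::euclidean_space \<Rightarrow> real \<Rightarrow> real) \<Rightarrow> real \<Rightarrow> real \<Rightarrow> ('a \<Rightarrow> real \<Rightarrow> ennreal) \<Rightarrow> bool" where
  "is_solution G p T u \<longleftrightarrow>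
     measurable_upto T u \<and>
     (AE (x, \<tau>, t) in lebesgue. 0 < \<tau> \<and> \<tau> < t \<and> t < T \<longrightarrow>
        u x t < \<infinity> \<and>
        u x t = (\<integral>\<^sup>+y. ennreal (G (x - y) (t - \<tau>)) * u y \<tau> \<partial>lebesgue) + duhamel G p u \<tau> x t)"

text \<open>On \<open>\<real>\<^sup>N\<close> a locally finite Borel measure is automatically regular.\<close>

definition radon_measure :: "'a::euclidean_space measure \<Rightarrow> bool" where
  "radon_measure \<mu> \<longleftrightarrow> sets \<mu> = sets borel \<and> (\<forall>K. compact K \<longrightarrow> emeasure \<mu> K < \<infinity>)"

definition is_cauchy_solution ::
  "('a::euclidean_space \<Rightarrow> real \<Rightarrow> real) \<Rightarrow> real \<Rightarrow> real \<Rightarrow> 'a measure \<Rightarrow>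
     ('a \<Rightarrow> real \<Rightarrow> ennreal) \<Rightarrow> bool" where
  "is_cauchy_solution G p T \<mu> u \<longleftrightarrow>
     measurable_upto T u \<and>
     (AE (x, t) in lebesgue. 0 < t \<and> t < T \<longrightarrow>
        u x t < \<infinity> \<and>
        u x t = (\<integral>\<^sup>+y. ennreal (G (x - y) t) \<partial>\<mu>) + duhamel G p u 0 x t)"

definition C0 :: "('a::euclidean_space \<Rightarrow> real) set" where
  "C0 = {\<phi>. continuous_on UNIV \<phi> \<and> compact (closure {x. \<phi> x \<noteq> 0})}"

definition ess_lim_0 :: "(real \<Rightarrow> real) \<Rightarrow> real \<Rightarrow> bool" where
  "ess_lim_0 f L \<longleftrightarrow> (\<exists>E\<in>null_sets lebesgue. (f \<longlongrightarrow> L) (at 0 within ({0<..} - E)))"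

text \<open>
  The integral on the left is a Bochner integral of a signed function. For a solution \<open>u\<close> and almost
  every \<open>t\<close> the function \<open>u(\<cdot>,t)\<close> is finite almost everywhere and, since \<open>G\<close> is positive and
  continuous, locally integrable; so neither the convention \<open>enn2real \<infinity> = 0\<close> nor
  the value 0 of undefined integrals interferes with the essential limit.
\<close>

definition initial_trace ::
  "('a::euclidean_space \<Rightarrow> real \<Rightarrow> ennreal) \<Rightarrow> 'a measure \<Rightarrow> bool" where
  "initial_trace u \<mu> \<longleftrightarrow>
     (\<forall>\<phi>\<in>C0. ess_lim_0 (\<lambda>t. \<integral>y. enn2real (u y t) * \<phi> y \<partial>lebesgue) (\<integral>y. \<phi> y \<partial>\<mu>))"

end

theory Submission
  imports Defs
begin

text \<open>
  Only positivity, continuity and unit mass of \<open>G\<close> matter. For almost every \<open>(x, t)\<close> the identities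
  for different \<open>\<tau>\<close> share the left-hand side \<open>u x t\<close>, so
  \<open>m \<tau> = (\<integral>G(x - y, t - \<tau>) u(y, \<tau>) dy)\<close> satisfies, without any use of the semigroup property of
  \<open>G\<close>, the relation \<open>m(\<tau>') - m(\<tau>) = \<integral>\<^bsub>\<tau>\<^esub>\<^bsup>\<tau>'\<^esup> (G(t - s) * u(s)\<^sup>p)(x) ds\<close>. By Jensen's inequality
  \<open>m' \<ge> c m\<^sup>p\<close>, and since \<open>m\<close> is finite up to time \<open>t\<close>, it follows that
  \<open>m \<tau> \<le> C (t - \<tau>) powr (-1 / (p - 1))\<close> with \<open>C\<close> independent of \<open>x\<close>. Hence the masses of \<open>u(\<tau>)\<close> on the
  translates of a bounded set are bounded uniformly for \<open>\<tau> < t / 2\<close>.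

  For a bounded set \<open>A\<close> the integral of \<open>m\<close> over \<open>x \<in> A\<close> is \<open>\<integral>(1\<^sub>A * G(t - \<tau>))(y) u(y, \<tau>) dy\<close>. By the uniform mass
  bound, replacing \<open>t - \<tau>\<close> by \<open>t\<close> costs at most a multiple of the \<open>L\<^sup>1\<close> distance of the kernels, and
  discarding large \<open>y\<close> at most a multiple of a tail of \<open>\<integral>G(z, t) dz\<close>; no decay estimate of \<open>G\<close> is
  needed. What remains is a continuous test function of compact support, so the initial trace gives
  the limit \<open>\<integral>(1\<^sub>A * G(t)) d\<mu>\<close>.
\<close>

section \<open>Preliminaries on Lebesgue measure and power functions\<close>

text \<open>\<open>P\<close> is arbitrary, while \<open>AE_commute\<close> asks for a measurable
  set; the swap is therefore done for the complement of a measurable null set covering the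
  exceptions.\<close>

lemma (in pair_sigma_finite) AE_pair_swap:
  assumes "AE z in M1 \<Otimes>\<^sub>M M2. P z"
  shows "AE y in M2. AE x in M1. P (x, y)"
proof -
  obtain N where N: "N \<in> null_sets (M1 \<Otimes>\<^sub>M M2)" "{z \<in> space (M1 \<Otimes>\<^sub>M M2). \<not> P z} \<subseteq> N"
    using assms unfolding eventually_ae_filter by auto
  have [measurable]: "N \<in> sets (M1 \<Otimes>\<^sub>M M2)"
    using N by auto
  have "AE z in M1 \<Otimes>\<^sub>M M2. z \<notin> N"
    using N by (intro AE_not_in)
  from AE_pair[OF this] have "AE x in M1. AE y in M2. (x, y) \<notin> N" .
  then have "AE y in M2. AE x in M1. (x, y) \<notin> N"
    by (subst (asm) AE_commute) auto
  then show ?thesis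
    using AE_space
  proof eventually_elim
    case (elim y)
    from elim(1) AE_space show ?case
      by eventually_elim (use N elim(2) in \<open>auto simp: space_pair_measure\<close>)
  qed
qed

lemma nn_integral_lborel_shift:
  fixes f :: "'a::euclidean_space \<Rightarrow> ennreal"
  assumes [measurable]: "f \<in> borel_measurable borel"
  shows "(\<integral>\<^sup>+x. f (x + c) \<partial>lborel) = (\<integral>\<^sup>+x. f x \<partial>lborel)"
proof -
  have "(\<integral>\<^sup>+x. f x \<partial>lborel) = (\<integral>\<^sup>+x. f x \<partial>distr lborel borel ((+) c))"
    by (simp add: lborel_distr_plus)
  also have "\<dots> = (\<integral>\<^sup>+x. f (c + x) \<partial>lborel)"
    by (subst nn_integral_distr) auto
  finally show ?thesis
    by (simp add: add.commute)
qed

lemma nn_integral_reflect: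
  fixes f :: "'a::euclidean_space \<Rightarrow> ennreal"
  assumes [measurable]: "f \<in> borel_measurable borel"
  shows "(\<integral>\<^sup>+y. f (x - y) \<partial>lborel) = (\<integral>\<^sup>+y. f y \<partial>lborel)"
proof -
  have "(\<integral>\<^sup>+y. f y \<partial>lborel) = (\<integral>\<^sup>+y. f y \<partial>distr lborel borel (\<lambda>y. x + (- 1) *\<^sub>R y))"
    using lborel_affine[of "-1 :: real" x] by (simp add: density_1 power_abs)
  also have "\<dots> = (\<integral>\<^sup>+y. f (x - y) \<partial>lborel)"
    by (subst nn_integral_distr) auto
  finally show ?thesis ..
qed

text \<open>Tonelli after the substitution x = y + z moves the translation from \<open>f\<close>
  onto \<open>A\<close>. This is a Young-type inequality: \<open>w\<close> enters only through its
  mass on translates of \<open>A\<close>, and \<open>f\<close> only through its total mass.\<close>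

lemma nn_integral_convolution_le:
  fixes f w :: "'a::euclidean_space \<Rightarrow> ennreal"
  assumes [measurable]: "f \<in> borel_measurable borel" "w \<in> borel_measurable borel" "A \<in> sets borel"
    and C: "\<And>z. (\<integral>\<^sup>+y. indicator A (y + z) * w y \<partial>lborel) \<le> C"
  shows "(\<integral>\<^sup>+y. (\<integral>\<^sup>+x. indicator A x * f (x - y) \<partial>lborel) * w y \<partial>lborel) \<le> C * (\<integral>\<^sup>+z. f z \<partial>lborel)"
proof -
  have "(\<integral>\<^sup>+x. indicator A x * f (x - y) \<partial>lborel) = (\<integral>\<^sup>+z. indicator A (y + z) * f z \<partial>lborel)" for y
    using nn_integral_lborel_shift[of "\<lambda>x. indicator A x * f (x - y)" y] by (simp add: add.commute)
  then have "(\<integral>\<^sup>+y. (\<integral>\<^sup>+x. indicator A x * f (x - y) \<partial>lborel) * w y \<partial>lborel)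
      = (\<integral>\<^sup>+y. (\<integral>\<^sup>+z. indicator A (y + z) * f z * w y \<partial>lborel) \<partial>lborel)"
    by (simp add: nn_integral_multc)
  also have "\<dots> = (\<integral>\<^sup>+z. (\<integral>\<^sup>+y. indicator A (y + z) * f z * w y \<partial>lborel) \<partial>lborel)"
    by (rule lborel_pair.Fubini') measurable
  also have "\<dots> = (\<integral>\<^sup>+z. (\<integral>\<^sup>+y. indicator A (y + z) * w y \<partial>lborel) * f z \<partial>lborel)"
    by (subst nn_integral_multc[symmetric]) (auto simp: ac_simps)
  also have "\<dots> \<le> (\<integral>\<^sup>+z. C * f z \<partial>lborel)"
    by (intro nn_integral_mono mult_right_mono C) auto
  also have "\<dots> = C * (\<integral>\<^sup>+z. f z \<partial>lborel)"
    by (simp add: nn_integral_cmult)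
  finally show ?thesis .
qed

lemma measurable_ennpowr [measurable]: "(\<lambda>a. ennpowr a p) \<in> borel_measurable borel"
  unfolding ennpowr_def by measurable

text \<open>A crude substitute for the tangent line of the convex power. If \<open>w\<close> is at
  most \<open>b\<close>, the second summand on the right suffices, otherwise the first.\<close>

lemma ennpowr_ge_linear:
  assumes "0 < b" "1 < p"
  shows "ennreal (b powr (p - 1)) * w \<le> ennpowr w p + ennreal (b powr p)"
proof (cases w)
  case (real r)
  have "b powr (p - 1) * r \<le> r powr p + b powr p"
  proof (cases "r \<le> b")
    case True
    then have "b powr (p - 1) * r \<le> b powr (p - 1) * b"
      by (intro mult_left_mono) auto
    also have "\<dots> = b powr p"
      using assms by (simp add: powr_diff)
    finally show ?thesis
      by (smt (verit) powr_ge_zero)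
  next
    case False
    then have "b powr (p - 1) * r \<le> r powr (p - 1) * r"
      using assms by (intro mult_right_mono powr_mono2) auto
    also have "\<dots> = r powr p"
      using assms False by (simp add: powr_diff)
    finally show ?thesis
      by (smt (verit) powr_ge_zero)
  qed
  then show ?thesis
    using real by (simp add: ennpowr_def ennreal_mult[symmetric] ennreal_plus[symmetric] del: ennreal_plus)
qed (simp add: ennpowr_def)

text \<open>Jensen's inequality with the loss of a factor \<open>2 powr p\<close>, which is harmless for a blow-up argument.\<close>

lemma ennpowr_average_ge:
  fixes k w :: "'a \<Rightarrow> ennreal"
  assumes [measurable]: "k \<in> borel_measurable M" "w \<in> borel_measurable M"
    and k: "(\<integral>\<^sup>+x. k x \<partial>M) = 1" and "1 < p" "0 < a" "ennreal a \<le> (\<integral>\<^sup>+x. k x * w x \<partial>M)"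
  shows "ennreal ((a / 2) powr p) \<le> (\<integral>\<^sup>+x. k x * ennpowr (w x) p \<partial>M)"
proof -
  \<comment> \<open>With this \<open>b\<close>, the quantity \<open>b powr (p - 1) * a\<close> is
    twice the loss \<open>b powr p\<close> of the linear bound, so one copy survives.\<close>
  define b where "b = a / 2"
  have b: "0 < b" "a = 2 * b" using assms by (auto simp: b_def)
  have bp: "b powr (p - 1) * a = b powr p + b powr p"
    using b by (simp add: powr_diff)
  have "ennreal (b powr p) + ennreal (b powr p) = ennreal (b powr (p - 1)) * ennreal a"
    using b bp by (simp add: ennreal_mult[symmetric] ennreal_plus[symmetric] del: ennreal_plus)
  also have "\<dots> \<le> ennreal (b powr (p - 1)) * (\<integral>\<^sup>+x. k x * w x \<partial>M)"
    by (intro mult_left_mono assms) auto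
  also have "\<dots> = (\<integral>\<^sup>+x. k x * (ennreal (b powr (p - 1)) * w x) \<partial>M)"
    by (subst nn_integral_cmult[symmetric]) (auto simp: ac_simps)
  also have "\<dots> \<le> (\<integral>\<^sup>+x. k x * (ennpowr (w x) p + ennreal (b powr p)) \<partial>M)"
    by (intro nn_integral_mono mult_left_mono ennpowr_ge_linear b assms) auto
  also have "\<dots> = (\<integral>\<^sup>+x. k x * ennpowr (w x) p \<partial>M) + ennreal (b powr p)"
    by (simp add: distrib_left nn_integral_add nn_integral_multc k)
  finally show ?thesis
    unfolding b_def[symmetric] by (metis add.commute ennreal_add_left_cancel_le ennreal_neq_top infinity_ennreal_def)
qed

section \<open>A blow-up bound\<close>

lemma AE_lborel_ex:
  fixes a b :: real
  assumes "AE x in lborel. P x" "a < b"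
  shows "\<exists>x. a < x \<and> x < b \<and> P x"
proof (rule ccontr)
  assume "\<not> ?thesis"
  with assms(1) have "AE x in lborel. x \<notin> {a<..<b}"
    by (auto elim: eventually_mono)
  then have "{a<..<b} \<in> null_sets lborel"
    by (subst AE_iff_null_sets) auto
  with \<open>a < b\<close> show False
    by (simp add: null_sets_def)
qed

text \<open>Doubling from height \<open>2 ^ k * a\<close> takes time
  \<open>2 powr p * (2 ^ k * a) powr (1 - p)\<close>; these times form a geometric series of ratio
  \<open>2 powr (1 - p)\<close>. The constant times \<open>a powr (1 - p)\<close> is twice its
  sum.\<close>

definition blowup_const :: "real \<Rightarrow> real" where
  "blowup_const p = 2 * 2 powr p / (1 - 2 powr (1 - p))"

text \<open>
  The hypotheses say that \<open>m\<close> satisfies \<open>m' = q \<ge> (m / 2) powr p\<close>. Hence \<open>m\<close> doubles from \<open>a\<close> to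
  \<open>2 a\<close> within time \<open>2 powr p * a powr (1 - p)\<close>, and the successive doubling times have a finite
  sum. As \<open>m\<close> stays below \<open>V\<close>, this sum must exceed the remaining time \<open>t - \<tau>\<close>. The factor \<open>2\<close> in \<^const>\<open>blowup_const\<close> leaves
  room to avoid exceptional times.
\<close>

lemma blowup_bound:
  fixes m q :: "real \<Rightarrow> ennreal"
  assumes [measurable]: "q \<in> borel_measurable borel"
    and p: "1 < p" and V: "V < \<infinity>"
    and m_eq: "AE \<tau> in lborel. 0 < \<tau> \<and> \<tau> < t \<longrightarrow> V = m \<tau> + (\<integral>\<^sup>+s\<in>{\<tau><..<t}. q s \<partial>lborel)"
    and q_ge: "AE s in lborel. 0 < s \<and> s < t \<longrightarrow>
      (\<forall>a>0. ennreal a \<le> m s \<longrightarrow> ennreal ((a / 2) powr p) \<le> q s)"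
  shows "AE \<tau> in lborel. 0 < \<tau> \<and> \<tau> < t \<longrightarrow>
    m \<tau> \<le> ennreal ((blowup_const p / (t - \<tau>)) powr (1 / (p - 1)))"
proof -
  define eq where "eq s \<longleftrightarrow> V = m s + (\<integral>\<^sup>+r\<in>{s<..<t}. q r \<partial>lborel)" for s
  define good where "good s \<longleftrightarrow> 0 < s \<and> s < t \<and> eq s \<and>
      (\<forall>a>0. ennreal a \<le> m s \<longrightarrow> ennreal ((a / 2) powr p) \<le> q s)" for s
  have good: "AE s in lborel. 0 < s \<and> s < t \<longrightarrow> good s"
    using m_eq q_ge by eventually_elim (simp add: good_def eq_def)
  \<comment> \<open>The identities at \<open>s\<close> and \<open>s'\<close> share the left-hand
    side \<open>V\<close> and can be subtracted: the common integral over \<open>{s'<..<t}\<close>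
    is finite because \<open>V\<close> is.\<close>
  have step: "m s + x \<le> m s'"
    if "good s" "good s'" "s < s'" "x \<le> (\<integral>\<^sup>+r\<in>{s<..<s'}. q r \<partial>lborel)" for s s' x
  proof -
    let ?I = "\<integral>\<^sup>+r\<in>{s'<..<t}. q r \<partial>lborel"
    have "(\<integral>\<^sup>+r\<in>{s<..<s'}. q r \<partial>lborel) + ?I = (\<integral>\<^sup>+r. q r * indicator {s<..<s'} r + q r * indicator {s'<..<t} r \<partial>lborel)"
      by (subst nn_integral_add) auto
    also have "\<dots> \<le> (\<integral>\<^sup>+r\<in>{s<..<t}. q r \<partial>lborel)"
      using that by (intro nn_integral_mono) (auto simp: good_def indicator_def)
    finally have le: "(\<integral>\<^sup>+r\<in>{s<..<s'}. q r \<partial>lborel) + ?I \<le> (\<integral>\<^sup>+r\<in>{s<..<t}. q r \<partial>lborel)" .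
    have "m s + x + ?I = m s + (x + ?I)"
      by (rule add.assoc)
    also have "\<dots> \<le> m s + ((\<integral>\<^sup>+r\<in>{s<..<s'}. q r \<partial>lborel) + ?I)"
      by (intro add_left_mono add_right_mono that)
    also have "\<dots> \<le> m s + (\<integral>\<^sup>+r\<in>{s<..<t}. q r \<partial>lborel)"
      by (intro add_left_mono le)
    also have "\<dots> = V"
      using that(1) by (simp add: good_def eq_def)
    finally have "m s + x + ?I \<le> V" .
    moreover have V_eq: "V = m s' + ?I"
      using that(2) by (simp add: good_def eq_def)
    ultimately have "?I + (m s + x) \<le> ?I + m s'"
      by (simp only: add.commute)
    moreover have "?I < \<infinity>"
      using V unfolding V_eq by simp
    ultimately show ?thesis
      by (auto simp: ennreal_add_left_cancel_le)
  qed
  have mono: "m s \<le> m s'" if "good s" "good s'" "s < s'" for s s'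
    using step[OF that, of 0] by simp
  \<comment> \<open>By monotonicity \<open>m\<close> stays above \<open>a\<close> after time
    \<open>s\<close>, so \<open>q\<close> is at least \<open>(a / 2) powr p\<close> almost
    everywhere on the interval.\<close>
  have grow: "m s + ennreal ((s' - s) * (a / 2) powr p) \<le> m s'"
    if s: "good s" "good s'" "s < s'" and a: "0 < a" "ennreal a \<le> m s" for s s' a
  proof (rule step[OF s])
    have "ennreal ((s' - s) * (a / 2) powr p) = (\<integral>\<^sup>+r. ennreal ((a / 2) powr p) * indicator {s<..<s'} r \<partial>lborel)"
      using s by (subst nn_integral_cmult_indicator) (auto simp: ennreal_mult[symmetric] mult.commute)
    also have "\<dots> \<le> (\<integral>\<^sup>+r\<in>{s<..<s'}. q r \<partial>lborel)"
    proof (rule nn_integral_mono_AE)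
      show "AE r in lborel. ennreal ((a / 2) powr p) * indicator {s<..<s'} r \<le> q r * indicator {s<..<s'} r"
        using good
      proof eventually_elim
        case (elim r)
        show ?case
        proof (cases "r \<in> {s<..<s'}")
          case True
          then have r: "good r"
            using elim s by (auto simp: good_def)
          with True s a mono[of s r] have "ennreal a \<le> m r"
            by auto
          with r a True show ?thesis
            by (auto simp: good_def)
        qed auto
      qed
    qed
    finally show "ennreal ((s' - s) * (a / 2) powr p) \<le> (\<integral>\<^sup>+r\<in>{s<..<s'}. q r \<partial>lborel)" .
  qed
  define c where "c = blowup_const p"
  define d where "d = 2 powr p"
  define r :: real where "r = 2 powr (1 - p)"
  have r: "0 < r" "r < 1" and d: "0 < d"
    using p by (auto simp: r_def d_def powr_less_one)
  have c: "c = 2 * d / (1 - r)"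
    by (simp add: c_def d_def r_def blowup_const_def)
  \<comment> \<open>The identity makes the time budget reproduce itself: of
    \<open>c * a powr (1 - p)\<close>, at most \<open>2 * d * a powr (1 - p)\<close> is spent on one
    doubling, and \<open>c * (2 * a) powr (1 - p)\<close> is left.\<close>
  have c_pos: "0 < c" and c_ge: "2 * d + c * r = c"
    using r d by (auto simp: c field_simps)
  have double: "\<exists>s'. good s' \<and> ennreal (2 * a) \<le> m s' \<and> c * (2 * a) powr (1 - p) \<le> t - s'"
    if "good s" "0 < a" "ennreal a \<le> m s" "c * a powr (1 - p) \<le> t - s" for s a
  proof -
    \<comment> \<open>In time \<open>e\<close> the growth rate \<open>(a / 2) powr p\<close> adds
      exactly \<open>a\<close>. The interval from \<open>s + e\<close> to \<open>s + 2 * e\<close>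
      then contains a good time.\<close>
    define e where "e = d * a powr (1 - p)"
    have e: "0 < e" using d that by (simp add: e_def)
    obtain s' where s': "s + e < s'" "s' < s + 2 * e" "0 < s' \<and> s' < t \<longrightarrow> good s'"
      using AE_lborel_ex[OF good, of "s + e" "s + 2 * e"] e by auto
    have r_eq: "(2 * a) powr (1 - p) = r * a powr (1 - p)"
      using that by (simp add: powr_mult r_def)
    have eq: "2 * e + c * (r * a powr (1 - p)) = c * a powr (1 - p)"
      using arg_cong[OF c_ge, of "\<lambda>x. x * a powr (1 - p)"] by (simp add: e_def algebra_simps)
    have "0 < c * (r * a powr (1 - p))"
      using c_pos r that by simp
    with eq s' that have "s' < t"
      by linarith
    moreover have "0 < s'"
      using that s' e by (auto simp: good_def)
    ultimately have good': "good s'" using s' by auto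
    have "a \<le> (s' - s) * (a / 2) powr p"
    proof -
      have "a = e * (a / 2) powr p"
        using that by (simp add: e_def d_def powr_divide powr_diff)
      also have "\<dots> \<le> (s' - s) * (a / 2) powr p"
        using s' by (intro mult_right_mono) auto
      finally show ?thesis .
    qed
    have "ennreal (2 * a) = ennreal a + ennreal a"
      using that by (simp flip: ennreal_plus)
    also have "\<dots> \<le> ennreal a + ennreal ((s' - s) * (a / 2) powr p)"
      by (intro add_left_mono ennreal_leI) fact
    also have "\<dots> \<le> m s + ennreal ((s' - s) * (a / 2) powr p)"
      by (intro add_right_mono that)
    also have "\<dots> \<le> m s'"
      using s' e by (intro grow good' that) auto
    finally have "ennreal (2 * a) \<le> m s'" .
    moreover have "c * (2 * a) powr (1 - p) \<le> t - s'"
      unfolding r_eq using s' eq that by linarith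
    ultimately show ?thesis
      using good' by blast
  qed
  \<comment> \<open>Iterated doubling puts \<open>2 ^ k * a\<close> below \<open>V\<close> for every
    \<open>k\<close>, against the finiteness of \<open>V\<close>.\<close>
  have bound: False if "good s" "0 < a" "ennreal a \<le> m s" "c * a powr (1 - p) \<le> t - s" for s a
  proof -
    have iter: "\<exists>s. good s \<and> ennreal (2 ^ k * a) \<le> m s \<and> c * (2 ^ k * a) powr (1 - p) \<le> t - s" for k
    proof (induction k)
      case 0
      then show ?case using that by auto
    next
      case (Suc k)
      then obtain s where "good s" "ennreal (2 ^ k * a) \<le> m s" "c * (2 ^ k * a) powr (1 - p) \<le> t - s"
        by blast
      from double[OF this(1) _ this(2,3)] that(2) show ?case
        by (auto simp: mult.assoc)
    qed
    obtain v where v: "0 \<le> v" "V = ennreal v"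
      using V by (cases V) auto
    obtain k where "v / a < 2 ^ k"
      using real_arch_pow[of 2 "v / a"] by auto
    then have "v < 2 ^ k * a"
      using that by (simp add: field_simps)
    moreover obtain s where "good s" "ennreal (2 ^ k * a) \<le> m s"
      using iter by blast
    then have "ennreal (2 ^ k * a) \<le> V"
      by (simp add: good_def eq_def add_increasing2)
    ultimately show False
      using v by simp
  qed
  show ?thesis
    using good
  proof eventually_elim
    case (elim \<tau>)
    show ?case
    proof
      assume \<tau>: "0 < \<tau> \<and> \<tau> < t"
      \<comment> \<open>The height whose time budget \<open>c * b powr (1 - p)\<close> is exactly
        the remaining time \<open>t - \<tau>\<close>.\<close>
      define b where "b = (c / (t - \<tau>)) powr (1 / (p - 1))"
      have b: "0 < b"
        using \<tau> c_pos by (auto simp: b_def)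
      have "b powr (1 - p) = (c / (t - \<tau>)) powr - 1"
        using p unfolding b_def powr_powr by (intro arg_cong2[of _ _ _ _ "(powr)"] refl) (simp add: field_simps)
      then have "c * b powr (1 - p) = t - \<tau>"
        using \<tau> c_pos by (simp add: powr_minus)
      with bound[of \<tau> b] b elim \<tau> have "\<not> ennreal b \<le> m \<tau>"
        by auto
      then show "m \<tau> \<le> ennreal ((blowup_const p / (t - \<tau>)) powr (1 / (p - 1)))"
        by (simp add: b_def c_def)
    qed
  qed
qed

section \<open>Positive kernels of unit mass\<close>

text \<open>Interchange of two limits: \<open>e\<close> is uniform in \<open>n\<close> and
  \<open>\<delta>\<close> uniform in \<open>k\<close>. Errors are added rather than subtracted,
  since subtraction in \<open>ennreal\<close> truncates. The lower estimate has no
  \<open>\<delta>\<close> because in the application truncation only decreases the integral.\<close>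

lemma tendsto_ennreal_approx:
  fixes a e \<delta> \<beta> :: "nat \<Rightarrow> ennreal" and b :: "nat \<Rightarrow> nat \<Rightarrow> ennreal"
  assumes b: "\<And>n. b n \<longlonglongrightarrow> \<beta> n" and \<beta>: "\<beta> \<longlonglongrightarrow> l" and e: "e \<longlonglongrightarrow> 0" and \<delta>: "\<delta> \<longlonglongrightarrow> 0"
    and lower: "\<And>n k. b n k \<le> a k + e k" and upper: "\<And>n k. a k \<le> b n k + \<delta> n + e k"
  shows "a \<longlonglongrightarrow> l"
proof (rule order_tendstoI)
  fix y assume "y < l"
  then obtain n where "y < \<beta> n"
    using order_tendstoD(1)[OF \<beta>] eventually_happens'[OF sequentially_bot] by blast
  then obtain z where z: "y < z" "z < \<beta> n"
    using dense by blast
  have "(\<lambda>k. y + e k) \<longlonglongrightarrow> y + 0"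
    by (intro tendsto_intros e)
  then have "\<forall>\<^sub>F k in sequentially. y + e k < z"
    using z by (intro order_tendstoD) auto
  moreover have "\<forall>\<^sub>F k in sequentially. z < b n k"
    using b z by (intro order_tendstoD)
  ultimately show "\<forall>\<^sub>F k in sequentially. y < a k"
  proof eventually_elim
    case (elim k)
    show ?case
    proof (rule ccontr)
      assume "\<not> y < a k"
      then have "a k + e k \<le> y + e k"
        by (intro add_right_mono) auto
      with lower[of n k] have "b n k \<le> y + e k"
        by (rule order_trans)
      with elim show False
        by order
    qed
  qed
next
  fix y assume y: "l < y"
  have "(\<lambda>n. \<beta> n + \<delta> n) \<longlonglongrightarrow> l + 0"
    by (intro tendsto_intros \<beta> \<delta>)
  then have "\<forall>\<^sub>F n in sequentially. \<beta> n + \<delta> n < y"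
    using y by (intro order_tendstoD) auto
  then obtain n where n: "\<beta> n + \<delta> n < y"
    using eventually_happens'[OF sequentially_bot] by blast
  have "(\<lambda>k. b n k + \<delta> n + e k) \<longlonglongrightarrow> \<beta> n + \<delta> n + 0"
    by (intro tendsto_intros b e)
  then have "\<forall>\<^sub>F k in sequentially. b n k + \<delta> n + e k < y"
    using n by (intro order_tendstoD) auto
  then show "\<forall>\<^sub>F k in sequentially. a k < y"
    by eventually_elim (use upper in \<open>blast intro: le_less_trans\<close>)
qed

text \<open>Scheffe's lemma: for densities of equal mass, pointwise convergence already gives
  convergence in L1, with no dominating function.\<close>

lemma tendsto_L1_of_mass_one:
  fixes f :: "nat \<Rightarrow> 'a \<Rightarrow> real" and g :: "'a \<Rightarrow> real"
  assumes [measurable]: "\<And>n. f n \<in> borel_measurable M" "g \<in> borel_measurable M"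
    and "\<And>n x. 0 \<le> f n x" "\<And>x. 0 \<le> g x"
    and "\<And>n. (\<integral>\<^sup>+x. ennreal (f n x) \<partial>M) = 1" "(\<integral>\<^sup>+x. ennreal (g x) \<partial>M) = 1"
    and "\<And>x. (\<lambda>n. f n x) \<longlonglongrightarrow> g x"
  shows "(\<lambda>n. \<integral>\<^sup>+x. ennreal \<bar>f n x - g x\<bar> \<partial>M) \<longlonglongrightarrow> 0"
proof -
  have "integrable M g"
    using assms by (intro integrableI_nonneg) auto
  then have "(\<lambda>n. \<integral>\<^sup>+x. norm (f n x - g x) \<partial>M) \<longlonglongrightarrow> 0"
    using assms by (intro Scheffe_lemma2) auto
  then show ?thesis by simp
qed

section \<open>Cutoff functions and measure-theoretic tools\<close>

definition cutoff :: "nat \<Rightarrow> 'a::real_normed_vector \<Rightarrow> real" where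
  "cutoff n x = max 0 (min 1 (real n + 1 - norm x))"

lemma cutoff_range: "0 \<le> cutoff n x" "cutoff n x \<le> 1"
  and cutoff_eq_1: "norm x \<le> real n \<Longrightarrow> cutoff n x = 1"
  and cutoff_eq_0: "real n + 1 \<le> norm x \<Longrightarrow> cutoff n x = 0"
  and cutoff_mono: "m \<le> n \<Longrightarrow> cutoff m x \<le> cutoff n x"
  by (auto simp: cutoff_def)

lemma continuous_cutoff: "continuous_on S (cutoff n)"
  unfolding cutoff_def by (intro continuous_intros)

lemma measurable_cutoff [measurable]:
  "(cutoff n :: 'a::euclidean_space \<Rightarrow> real) \<in> borel_measurable borel"
  by (intro borel_measurable_continuous_onI continuous_cutoff)

lemma SUP_cutoff: "(SUP n. a * ennreal (cutoff n x)) = a"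
proof (rule antisym)
  show "(SUP n. a * ennreal (cutoff n x)) \<le> a"
    using mult_left_mono[of "ennreal (cutoff n x)" 1 a for n]
    by (intro SUP_least) (auto simp: cutoff_range)
  obtain n where "norm x \<le> real n"
    using real_arch_simple by blast
  then show "a \<le> (SUP n. a * ennreal (cutoff n x))"
    by (intro SUP_upper2[of n]) (auto simp: cutoff_eq_1)
qed

lemma measurable_uncurry:
  fixes v :: "'a::second_countable_topology \<Rightarrow> 'b::second_countable_topology \<Rightarrow> 'c::topological_space"
  assumes "(\<lambda>(x, t). v x t) \<in> borel_measurable borel" and [measurable]: "f \<in> borel_measurable M" "g \<in> borel_measurable M"
  shows "(\<lambda>z. v (f z) (g z)) \<in> borel_measurable M"
  using measurable_compose[OF _ assms(1), of "\<lambda>z. (f z, g z)" M] by (simp add: borel_prod[symmetric])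

lemma radon_measure_sigma_finite:
  assumes "radon_measure \<mu>"
  shows "sigma_finite_measure \<mu>"
proof
  have "space \<mu> = UNIV"
    using assms sets_eq_imp_space_eq[of \<mu> borel] by (simp add: radon_measure_def)
  moreover have "(\<Union>n::nat. cball (0::'a) (real n)) = UNIV"
    using real_arch_simple by auto
  moreover have "cball (0::'a) (real n) \<in> sets \<mu> \<and> emeasure \<mu> (cball 0 (real n)) \<noteq> \<infinity>" for n
    using assms by (auto simp: radon_measure_def less_top)
  ultimately show "\<exists>A. countable A \<and> A \<subseteq> sets \<mu> \<and> \<Union> A = space \<mu> \<and> (\<forall>a\<in>A. emeasure \<mu> a \<noteq> \<infinity>)"
    by (intro exI[of _ "range (\<lambda>n::nat. cball 0 (real n))"]) auto
qed

text \<open>Exhaustion by balls extends the equality to all Borel sets, and densities with respect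
  to a sigma-finite measure are unique. Neither function has to be locally integrable, so the
  Duhamel term may be treated before it is known to be finite.\<close>

lemma AE_lborel_eqI_bounded:
  fixes f g :: "'a::euclidean_space \<Rightarrow> ennreal"
  assumes [measurable]: "f \<in> borel_measurable borel" "g \<in> borel_measurable borel"
    and eq: "\<And>A. bounded A \<Longrightarrow> A \<in> sets borel \<Longrightarrow>
      (\<integral>\<^sup>+x. indicator A x * f x \<partial>lborel) = (\<integral>\<^sup>+x. indicator A x * g x \<partial>lborel)"
  shows "AE x in lborel. f x = g x"
proof (rule sigma_finite_measure.density_unique[OF sigma_finite_lborel])
  show "density lborel f = density lborel g"
  proof (rule measure_eqI)
    fix A assume "A \<in> sets (density lborel f)"
    then have [measurable]: "A \<in> sets borel" by simp
    have union: "(\<Union>n. A \<inter> cball 0 (real n)) = A"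
      using real_arch_simple by auto
    have inc: "incseq (\<lambda>n. A \<inter> cball 0 (real n))"
      by (auto simp: incseq_def)
    have "emeasure (density lborel h) A = (SUP n. emeasure (density lborel h) (A \<inter> cball 0 (real n)))" for h
      using SUP_emeasure_incseq[OF _ inc, of "density lborel h"] unfolding union by (simp add: image_subset_iff)
    moreover have "emeasure (density lborel f) (A \<inter> cball 0 (real n)) = emeasure (density lborel g) (A \<inter> cball 0 (real n))" for n
      using eq[of "A \<inter> cball 0 (real n)"] by (simp add: emeasure_density bounded_Int mult.commute)
    ultimately show "emeasure (density lborel f) A = emeasure (density lborel g) A"
      by simp
  qed simp
qed measurable

section \<open>Kernel averages, their continuity, and local mass bounds\<close>

locale positive_kernel =
  fixes K :: "'a::euclidean_space \<Rightarrow> real \<Rightarrow> real"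
  assumes K_meas: "(\<lambda>(x, t). K x t) \<in> borel_measurable borel"
    and K_cont: "continuous_on (UNIV \<times> {0<..}) (\<lambda>(x, t). K x t)"
    and K_pos: "0 < t \<Longrightarrow> 0 < K x t"
    and K_mass: "0 < t \<Longrightarrow> (\<integral>\<^sup>+x. ennreal (K x t) \<partial>lborel) = 1"
begin

lemma measurable_K [measurable (raw)]:
  assumes [measurable]: "f \<in> borel_measurable M" "g \<in> borel_measurable M"
  shows "(\<lambda>x. K (f x) (g x)) \<in> borel_measurable M"
  using measurable_compose[OF _ K_meas, of "\<lambda>x. (f x, g x)" M] by (simp add: borel_prod[symmetric])

lemma tendsto_K:
  assumes "(f \<longlongrightarrow> x) F" "(g \<longlongrightarrow> t) F" "0 < t"
  shows "((\<lambda>n. K (f n) (g n)) \<longlongrightarrow> K x t) F"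
proof -
  have "open (UNIV \<times> {0::real<..})"
    by (intro open_Times) auto
  then have "isCont (\<lambda>(x, t). K x t) (x, t)"
    using K_cont assms(3) by (subst (asm) continuous_on_eq_continuous_at) auto
  from isCont_tendsto_compose[OF this tendsto_Pair[OF assms(1,2)]] show ?thesis
    by simp
qed

lemma K_mass_shift:
  assumes "0 < t"
  shows "(\<integral>\<^sup>+x. ennreal (K (x - y) t) \<partial>lborel) = 1"
  using nn_integral_lborel_shift[of "\<lambda>x. ennreal (K x t)" "- y"] K_mass[OF assms] by simp

lemma K_mass_reflect:
  assumes "0 < t"
  shows "(\<integral>\<^sup>+y. ennreal (K (x - y) t) \<partial>lborel) = 1"
  using nn_integral_reflect[of "\<lambda>y. ennreal (K y t)"] K_mass[OF assms] by simp

text \<open>The dual object to the evolution: by Tonelli, integrating \<open>avg A t\<close> against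
  \<open>w\<close> is the same as integrating the evolved \<open>w\<close> over \<open>A\<close>. As
  a function of \<open>y\<close> it will serve as the test function.\<close>

definition avg :: "'a set \<Rightarrow> real \<Rightarrow> 'a \<Rightarrow> ennreal" where
  "avg A t y = (\<integral>\<^sup>+x. indicator A x * ennreal (K (x - y) t) \<partial>lborel)"

lemma measurable_avg [measurable]:
  assumes [measurable]: "A \<in> sets borel"
  shows "avg A t \<in> borel_measurable borel"
  unfolding avg_def by measurable

lemma avg_le_1: "0 < t \<Longrightarrow> avg A t y \<le> 1"
  unfolding avg_def
  by (subst K_mass_shift[symmetric, of t y], assumption, intro nn_integral_mono)
    (auto simp: indicator_def)

text \<open>A triangle inequality covering both a change of centre, for continuity, and a change of
  time, for the limit.\<close>

lemma avg_le_add: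
  assumes [measurable]: "A \<in> sets borel"
  shows "avg A s y \<le> avg A t y' + (\<integral>\<^sup>+x. indicator A x * ennreal \<bar>K (x - y) s - K (x - y') t\<bar> \<partial>lborel)"
proof -
  have "avg A s y \<le> (\<integral>\<^sup>+x. indicator A x * ennreal (K (x - y') t) +
      indicator A x * ennreal \<bar>K (x - y) s - K (x - y') t\<bar> \<partial>lborel)"
    unfolding avg_def
  proof (rule nn_integral_mono)
    fix x
    have "ennreal (K (x - y) s) \<le> ennreal (K (x - y') t) + ennreal \<bar>K (x - y) s - K (x - y') t\<bar>"
    \<comment> \<open>The times are unrestricted here, so the kernel could be negative, where
      \<open>ennreal\<close> truncates it to 0.\<close>
    proof (cases "K (x - y') t \<ge> 0")
      case True
      then show ?thesis
        by (simp add: ennreal_leI flip: ennreal_plus)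
    next
      case False
      then show ?thesis
        by (simp add: ennreal_neg ennreal_leI)
    qed
    then show "indicator A x * ennreal (K (x - y) s) \<le> indicator A x * ennreal (K (x - y') t) +
      indicator A x * ennreal \<bar>K (x - y) s - K (x - y') t\<bar>"
      by (auto simp: indicator_def)
  qed
  also have "\<dots> = avg A t y' + (\<integral>\<^sup>+x. indicator A x * ennreal \<bar>K (x - y) s - K (x - y') t\<bar> \<partial>lborel)"
    unfolding avg_def by (rule nn_integral_add) measurable
  finally show ?thesis .
qed

text \<open>Translates of the kernel converge pointwise and all have mass one, hence they converge
  in L1.\<close>

lemma continuous_avg:
  assumes [measurable]: "A \<in> sets borel" and t: "0 < t"
  shows "continuous_on UNIV (\<lambda>y. enn2real (avg A t y))"
proof (rule continuous_at_imp_continuous_on, intro ballI, unfold continuous_at_sequentially, intro allI impI)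
  fix y Y assume Y: "Y \<longlonglongrightarrow> (y :: 'a)"
  define e where "e k = (\<integral>\<^sup>+x. ennreal \<bar>K (x - Y k) t - K (x - y) t\<bar> \<partial>lborel)" for k
  have "e \<longlonglongrightarrow> 0"
    unfolding e_def using t
    by (intro tendsto_L1_of_mass_one) (auto intro!: less_imp_le[OF K_pos] K_mass_shift tendsto_intros tendsto_K Y)
  have e_ge: "(\<integral>\<^sup>+x. indicator A x * ennreal \<bar>K (x - Y k) t - K (x - y) t\<bar> \<partial>lborel) \<le> e k" for k
    unfolding e_def by (intro nn_integral_mono) (auto simp: indicator_def)
  have "(\<lambda>k. avg A t (Y k)) \<longlonglongrightarrow> avg A t y"
  proof (rule tendsto_ennreal_approx[where b = "\<lambda>_ _. avg A t y" and \<beta> = "\<lambda>_. avg A t y" and \<delta> = "\<lambda>_. 0"])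
    show "e \<longlonglongrightarrow> 0" by fact
    show "avg A t y \<le> avg A t (Y k) + e k" for k
      using avg_le_add[of A t y t "Y k"] e_ge[of k] by (auto simp: abs_minus_commute intro: order_trans add_left_mono)
    show "avg A t (Y k) \<le> avg A t y + 0 + e k" for k
      using avg_le_add[of A t "Y k" t y] e_ge[of k] by (auto intro: order_trans add_left_mono)
  qed auto
  then show "((\<lambda>y. enn2real (avg A t y)) \<circ> Y) \<longlonglongrightarrow> enn2real (avg A t y)"
    unfolding comp_def using avg_le_1[OF t, of A y]
    by (intro tendsto_enn2real) (auto simp: ennreal_enn2real_if top_unique)
qed

text \<open>A positive continuous function has a positive minimum on a compact set. The times from
  \<open>t / 2\<close> to \<open>t\<close> are the values of \<open>t - \<tau>\<close> for
  \<open>\<tau>\<close> at most \<open>t / 2\<close>.\<close>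

lemma K_lower_bound:
  assumes "0 < t"
  obtains c where "0 < c" "\<And>s z. t / 2 \<le> s \<Longrightarrow> s \<le> t \<Longrightarrow> norm z \<le> r \<Longrightarrow> c \<le> K z s"
proof (cases "0 \<le> r")
  case True
  have "compact (cball (0::'a) r \<times> {t / 2..t})"
    by (intro compact_Times compact_cball compact_Icc)
  moreover have "cball (0::'a) r \<times> {t / 2..t} \<noteq> {}"
    using assms True by auto
  moreover have "continuous_on (cball (0::'a) r \<times> {t / 2..t}) (\<lambda>(x, t). K x t)"
    by (rule continuous_on_subset[OF K_cont]) (use assms in auto)
  ultimately obtain z0 where z0: "z0 \<in> cball 0 r \<times> {t / 2..t}"
    "\<And>z. z \<in> cball 0 r \<times> {t / 2..t} \<Longrightarrow> (\<lambda>(x, t). K x t) z0 \<le> (\<lambda>(x, t). K x t) z"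
    using continuous_attains_inf by metis
  show ?thesis
  proof
    show "0 < (\<lambda>(x, t). K x t) z0"
      using z0(1) assms by (auto intro!: K_pos)
    show "(\<lambda>(x, t). K x t) z0 \<le> K z s" if "t / 2 \<le> s" "s \<le> t" "norm z \<le> r" for z s
      using z0(2)[of "(z, s)"] that by auto
  qed
next
  case False
  then show ?thesis
    using that[of 1] by (smt (verit) norm_ge_zero)
qed

text \<open>Around a point where the evolved function is at most \<open>B\<close>, the kernel is
  bounded below on the translate of \<open>A\<close>. As the bound \<open>B\<close> holds only
  almost everywhere, that point is sought in the unit ball about \<open>- z\<close>, which accounts
  for the radius \<open>\<rho> + 1\<close>.\<close>

lemma local_mass_bound:
  assumes t: "0 < t" and "bounded A" and [measurable]: "A \<in> sets borel" and "B < \<infinity>"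
  obtains C where "C < \<infinity>" "\<And>s w z. t / 2 \<le> s \<Longrightarrow> s \<le> t \<Longrightarrow> w \<in> borel_measurable borel \<Longrightarrow>
    (AE x in lborel. (\<integral>\<^sup>+y. ennreal (K (x - y) s) * w y \<partial>lborel) \<le> B) \<Longrightarrow>
    (\<integral>\<^sup>+y. indicator A (y + z) * w y \<partial>lborel) \<le> C"
proof -
  obtain \<rho> where \<rho>: "\<And>x. x \<in> A \<Longrightarrow> norm x \<le> \<rho>"
    using \<open>bounded A\<close> by (auto simp: bounded_iff)
  obtain c where c: "0 < c" "\<And>s z. t / 2 \<le> s \<Longrightarrow> s \<le> t \<Longrightarrow> norm z \<le> \<rho> + 1 \<Longrightarrow> c \<le> K z s"
    using K_lower_bound[OF t] by blast
  show thesis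
  proof
    show "B / ennreal c < \<infinity>"
      using c \<open>B < \<infinity>\<close> by (simp add: ennreal_divide_eq_top_iff less_top[symmetric])
    fix s w z assume s: "t / 2 \<le> s" "s \<le> t" and [measurable]: "w \<in> borel_measurable borel"
      and ae: "AE x in lborel. (\<integral>\<^sup>+y. ennreal (K (x - y) s) * w y \<partial>lborel) \<le> B"
    have "\<exists>x\<in>ball (- z) 1. (\<integral>\<^sup>+y. ennreal (K (x - y) s) * w y \<partial>lborel) \<le> B"
    proof (rule ccontr)
      assume "\<not> ?thesis"
      with ae have "AE x in lborel. x \<notin> ball (- z) 1"
        by (auto elim: eventually_mono)
      then have "ball (- z) 1 \<in> null_sets lborel"
        by (subst AE_iff_null_sets) auto
      then show False
        using open_not_negligible[of "ball (- z) 1"]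
        by (auto simp: negligible_iff_null_sets null_sets_completionI)
    qed
    then obtain x where x: "norm (x + z) < 1" "(\<integral>\<^sup>+y. ennreal (K (x - y) s) * w y \<partial>lborel) \<le> B"
      by (auto simp: dist_norm norm_minus_commute[of "- z"])
    have "ennreal c * (\<integral>\<^sup>+y. indicator A (y + z) * w y \<partial>lborel)
        = (\<integral>\<^sup>+y. ennreal c * (indicator A (y + z) * w y) \<partial>lborel)"
      by (subst nn_integral_cmult) auto
    also have "\<dots> \<le> (\<integral>\<^sup>+y. ennreal (K (x - y) s) * w y \<partial>lborel)"
    proof (rule nn_integral_mono)
      fix y
      show "ennreal c * (indicator A (y + z) * w y) \<le> ennreal (K (x - y) s) * w y"
      proof (cases "y + z \<in> A")
        case True
        have "norm (x - y) \<le> norm (x + z) + norm (y + z)"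
          using norm_triangle_ineq4[of "x + z" "y + z"] by simp
        with \<rho>[OF True] x have "c \<le> K (x - y) s"
          by (intro c s) auto
        with True show ?thesis
          by (auto intro!: mult_right_mono ennreal_leI)
      qed auto
    qed
    also have "\<dots> \<le> B" by (rule x)
    finally show "(\<integral>\<^sup>+y. indicator A (y + z) * w y \<partial>lborel) \<le> B / ennreal c"
      using c divide_right_mono_ennreal[of "ennreal c * (\<integral>\<^sup>+y. indicator A (y + z) * w y \<partial>lborel)" B "ennreal c"]
      by (simp add: mult.commute[of "ennreal c"] ennreal_mult_divide_eq)
  qed
qed

text \<open>
  Both the replacement of \<open>s k\<close> by \<open>t\<close> and the truncation of the tails are controlled by
  \<open>nn_integral_convolution_le\<close>: no decay of the kernel beyond integrability is needed.
\<close>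

lemma tendsto_avg_integral:
  fixes w :: "nat \<Rightarrow> 'a \<Rightarrow> ennreal"
  assumes t: "0 < t" and s: "\<And>k. 0 < s k" "s \<longlonglongrightarrow> t"
    and A: "bounded A" and [measurable]: "A \<in> sets borel" and [measurable]: "\<And>k. w k \<in> borel_measurable borel"
    and \<mu>: "sets \<mu> = sets borel"
    and C: "C < \<infinity>" "\<And>k z. (\<integral>\<^sup>+y. indicator A (y + z) * w k y \<partial>lborel) \<le> C"
    and lim: "\<And>n. (\<lambda>k. \<integral>\<^sup>+y. avg A t y * ennreal (cutoff n y) * w k y \<partial>lborel) \<longlonglongrightarrow>
      (\<integral>\<^sup>+y. avg A t y * ennreal (cutoff n y) \<partial>\<mu>)"
  shows "(\<lambda>k. \<integral>\<^sup>+y. avg A (s k) y * w k y \<partial>lborel) \<longlonglongrightarrow> (\<integral>\<^sup>+y. avg A t y \<partial>\<mu>)"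
proof -
  note [measurable_cong] = \<mu>
  obtain \<rho> where \<rho>: "\<And>x. x \<in> A \<Longrightarrow> norm x \<le> \<rho>"
    using A by (auto simp: bounded_iff)
  define e where "e k = C * (\<integral>\<^sup>+x. ennreal \<bar>K x (s k) - K x t\<bar> \<partial>lborel)" for k
  \<comment> \<open>If \<open>x\<close> lies in \<open>A\<close> and \<open>y\<close> outside the
    ball of radius \<open>n\<close>, then \<open>x - y\<close> has norm at least
    \<open>real n - \<rho>\<close>; only this tail of the kernel is lost.\<close>
  define \<delta> where "\<delta> n = C * (\<integral>\<^sup>+x. ennreal (K x t) * indicator {x. real n - \<rho> \<le> norm x} x \<partial>lborel)" for n
  define D where "D k y = (\<integral>\<^sup>+x. indicator A x * ennreal \<bar>K (x - y) (s k) - K (x - y) t\<bar> \<partial>lborel)" for k y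
  have D_meas [measurable]: "D k \<in> borel_measurable borel" for k
    unfolding D_def by measurable
  have D_le: "(\<integral>\<^sup>+y. D k y * w k y \<partial>lborel) \<le> e k" for k
    unfolding D_def e_def
    using nn_integral_convolution_le[of "\<lambda>x. ennreal \<bar>K x (s k) - K x t\<bar>" "w k" A C] C by simp
  show ?thesis
  proof (rule tendsto_ennreal_approx[OF lim])
    have "(\<lambda>k. \<integral>\<^sup>+x. ennreal \<bar>K x (s k) - K x t\<bar> \<partial>lborel) \<longlonglongrightarrow> 0"
      using t s by (intro tendsto_L1_of_mass_one) (auto intro!: less_imp_le[OF K_pos] K_mass tendsto_intros tendsto_K)
    then have "e \<longlonglongrightarrow> C * 0"
      unfolding e_def using C by (intro ennreal_tendsto_cmult) auto
    then show "e \<longlonglongrightarrow> 0" by simp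
    have "(\<lambda>n. \<integral>\<^sup>+x. ennreal (K x t) * indicator {x. real n - \<rho> \<le> norm x} x \<partial>lborel) \<longlonglongrightarrow> (\<integral>\<^sup>+(x::'a). 0 \<partial>lborel)"
    proof (rule nn_integral_dominated_convergence[where w = "\<lambda>x. ennreal (K x t)"])
      show "AE x in lborel. (\<lambda>n. ennreal (K x t) * indicator {x. real n - \<rho> \<le> norm x} x) \<longlonglongrightarrow> 0"
      proof (intro AE_I2 tendsto_eventually)
        fix x :: 'a
        have "\<forall>\<^sub>F n in sequentially. norm x + \<rho> < real n"
          using filterlim_real_sequentially by (simp add: filterlim_at_top_dense)
        then show "\<forall>\<^sub>F n in sequentially. ennreal (K x t) * indicator {x. real n - \<rho> \<le> norm x} x = 0"
          by eventually_elim auto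
      qed
    qed (use t in \<open>auto simp: K_mass indicator_def\<close>)
    then have "\<delta> \<longlonglongrightarrow> C * 0"
      unfolding \<delta>_def using C by (intro ennreal_tendsto_cmult) auto
    then show "\<delta> \<longlonglongrightarrow> 0" by simp
    \<comment> \<open>Against \<open>\<mu>\<close> the cutoff is removed by monotone convergence,
      which also covers an infinite limit.\<close>
    have inc: "incseq (\<lambda>n y. avg A t y * ennreal (cutoff n y))"
      by (auto simp: incseq_def le_fun_def intro!: mult_left_mono ennreal_leI cutoff_mono)
    have "(\<integral>\<^sup>+y. avg A t y \<partial>\<mu>) = (\<integral>\<^sup>+y. (SUP n. avg A t y * ennreal (cutoff n y)) \<partial>\<mu>)"
      by (simp only: SUP_cutoff)
    also have "\<dots> = (SUP n. \<integral>\<^sup>+y. avg A t y * ennreal (cutoff n y) \<partial>\<mu>)"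
      by (rule nn_integral_monotone_convergence_SUP[OF inc]) measurable
    finally have "(\<integral>\<^sup>+y. avg A t y \<partial>\<mu>) = (SUP n. \<integral>\<^sup>+y. avg A t y * ennreal (cutoff n y) \<partial>\<mu>)" .
    moreover have "incseq (\<lambda>n. \<integral>\<^sup>+y. avg A t y * ennreal (cutoff n y) \<partial>\<mu>)"
      using inc by (auto simp: incseq_def le_fun_def intro!: nn_integral_mono)
    ultimately show "(\<lambda>n. \<integral>\<^sup>+y. avg A t y * ennreal (cutoff n y) \<partial>\<mu>) \<longlonglongrightarrow> (\<integral>\<^sup>+y. avg A t y \<partial>\<mu>)"
      using LIMSEQ_SUP by metis
  next
    fix n k
    have "(\<integral>\<^sup>+y. avg A t y * ennreal (cutoff n y) * w k y \<partial>lborel)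
        \<le> (\<integral>\<^sup>+y. avg A (s k) y * w k y + D k y * w k y \<partial>lborel)"
    proof (rule nn_integral_mono)
      fix y
      have "avg A t y * ennreal (cutoff n y) \<le> avg A t y * 1"
        by (intro mult_left_mono) (auto simp: cutoff_range)
      also have "\<dots> \<le> avg A (s k) y + D k y"
        using avg_le_add[of A t y "s k" y] by (simp add: D_def abs_minus_commute)
      finally show "avg A t y * ennreal (cutoff n y) * w k y \<le> avg A (s k) y * w k y + D k y * w k y"
        by (simp add: distrib_right[symmetric] mult_right_mono)
    qed
    also have "\<dots> = (\<integral>\<^sup>+y. avg A (s k) y * w k y \<partial>lborel) + (\<integral>\<^sup>+y. D k y * w k y \<partial>lborel)"
      by (rule nn_integral_add) measurable
    also have "\<dots> \<le> (\<integral>\<^sup>+y. avg A (s k) y * w k y \<partial>lborel) + e k"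
      by (intro add_left_mono D_le)
    finally show "(\<integral>\<^sup>+y. avg A t y * ennreal (cutoff n y) * w k y \<partial>lborel) \<le>
        (\<integral>\<^sup>+y. avg A (s k) y * w k y \<partial>lborel) + e k" .
    \<comment> \<open>\<open>T\<close> is the tail part of \<open>avg A t\<close>. Inside the ball
      of radius \<open>n\<close> the cutoff is 1; outside it, \<open>T\<close> dominates the whole
      average.\<close>
    define T where "T y = (\<integral>\<^sup>+x. indicator A x * (ennreal (K (x - y) t) * indicator {x. real n - \<rho> \<le> norm x} (x - y)) \<partial>lborel)" for y
    have T_meas [measurable]: "T \<in> borel_measurable borel"
      unfolding T_def by measurable
    have T_le: "(\<integral>\<^sup>+y. T y * w k y \<partial>lborel) \<le> \<delta> n"
      unfolding T_def \<delta>_def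
      using nn_integral_convolution_le[of "\<lambda>x. ennreal (K x t) * indicator {x. real n - \<rho> \<le> norm x} x" "w k" A C] C by simp
    have "(\<integral>\<^sup>+y. avg A (s k) y * w k y \<partial>lborel)
        \<le> (\<integral>\<^sup>+y. (avg A t y * ennreal (cutoff n y) * w k y + T y * w k y) + D k y * w k y \<partial>lborel)"
    proof (rule nn_integral_mono)
      fix y
      have "avg A t y \<le> avg A t y * ennreal (cutoff n y) + T y"
      proof (cases "norm y \<le> real n")
        case False
        have "avg A t y \<le> T y"
          unfolding avg_def T_def
        proof (rule nn_integral_mono)
          fix x
          show "indicator A x * ennreal (K (x - y) t) \<le>
              indicator A x * (ennreal (K (x - y) t) * indicator {x. real n - \<rho> \<le> norm x} (x - y))"
          proof (cases "x \<in> A")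
            case True
            have "norm y \<le> norm x + norm (x - y)"
              using norm_triangle_ineq4[of x "x - y"] by simp
            with False \<rho>[OF True] have "real n - \<rho> \<le> norm (x - y)"
              by linarith
            then show ?thesis by simp
          qed auto
        qed
        then show ?thesis
          by (rule order_trans) simp
      qed (simp add: cutoff_eq_1)
      then have "avg A t y + D k y \<le> avg A t y * ennreal (cutoff n y) + T y + D k y"
        by (rule add_right_mono)
      with avg_le_add[of A "s k" y t y] have "avg A (s k) y \<le> avg A t y * ennreal (cutoff n y) + T y + D k y"
        unfolding D_def by (auto intro: order_trans)
      then have "avg A (s k) y * w k y \<le> (avg A t y * ennreal (cutoff n y) + T y + D k y) * w k y"
        by (intro mult_right_mono) auto
      then show "avg A (s k) y * w k y \<le> (avg A t y * ennreal (cutoff n y) * w k y + T y * w k y) + D k y * w k y"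
        by (simp add: distrib_right)
    qed
    also have "\<dots> = (\<integral>\<^sup>+y. avg A t y * ennreal (cutoff n y) * w k y \<partial>lborel) + (\<integral>\<^sup>+y. T y * w k y \<partial>lborel) +
        (\<integral>\<^sup>+y. D k y * w k y \<partial>lborel)"
      by (subst nn_integral_add, measurable)+
    also have "\<dots> \<le> (\<integral>\<^sup>+y. avg A t y * ennreal (cutoff n y) * w k y \<partial>lborel) + \<delta> n + e k"
      by (intro add_mono order_refl T_le D_le)
    finally show "(\<integral>\<^sup>+y. avg A (s k) y * w k y \<partial>lborel) \<le>
      (\<integral>\<^sup>+y. avg A t y * ennreal (cutoff n y) * w k y \<partial>lborel) + \<delta> n + e k" .
  qed
qed

section \<open>Passing to the initial trace\<close>

abbreviation heat :: "('a \<Rightarrow> ennreal) \<Rightarrow> 'a \<Rightarrow> real \<Rightarrow> ennreal" where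
  "heat w x s \<equiv> (\<integral>\<^sup>+y. ennreal (K (x - y) s) * w y \<partial>lborel)"

text \<open>The trace hypothesis concerns real functions of compact support, whereas
  \<open>avg A t\<close> in general has unbounded support.\<close>

lemma avg_cutoff_in_C0:
  assumes [measurable]: "A \<in> sets borel" and "0 < t"
  shows "(\<lambda>y. enn2real (avg A t y) * cutoff n y) \<in> C0"
proof -
  have "{y. enn2real (avg A t y) * cutoff n y \<noteq> 0} \<subseteq> cball 0 (real n + 1)"
    by (rule subsetI, rule ccontr) (auto simp: cutoff_eq_0)
  then have "bounded {y. enn2real (avg A t y) * cutoff n y \<noteq> 0}"
    by (rule bounded_subset[rotated]) simp
  then show ?thesis
    unfolding C0_def using assms
    by (auto intro!: continuous_intros continuous_avg continuous_cutoff simp: compact_closure)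
qed

lemma avg_cutoff:
  assumes "0 < t"
  shows "ennreal (enn2real (avg A t y) * cutoff n y) = avg A t y * ennreal (cutoff n y)"
    and "avg A t y * ennreal (cutoff n y) \<le> indicator (cball 0 (real n + 1)) y"
proof -
  have avg: "avg A t y \<le> 1"
    by (rule avg_le_1) fact
  then show "ennreal (enn2real (avg A t y) * cutoff n y) = avg A t y * ennreal (cutoff n y)"
    by (auto simp: ennreal_mult cutoff_range ennreal_enn2real_if top_unique)
  show "avg A t y * ennreal (cutoff n y) \<le> indicator (cball 0 (real n + 1)) y"
  proof (cases "norm y \<le> real n + 1")
    case True
    then show ?thesis
      using mult_mono[OF avg, of "ennreal (cutoff n y)" 1] by (simp add: cutoff_range)
  qed (simp add: cutoff_eq_0)
qed

text \<open>For fixed \<open>x\<close> the blow-up bound applies to the evolved \<open>v\<close> as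
  a function of \<open>\<tau>\<close>; Jensen is available since the kernel has mass one in
  \<open>y\<close>.\<close>

lemma heat_average_bound:
  fixes v :: "'a \<Rightarrow> real \<Rightarrow> ennreal"
  assumes v: "(\<lambda>(x, t). v x t) \<in> borel_measurable borel"
    and p: "1 < p" and t: "0 < t"
    and sol: "AE x in lborel. AE \<tau> in lborel. 0 < \<tau> \<and> \<tau> < t \<longrightarrow>
      v x t < \<infinity> \<and> v x t = heat (\<lambda>y. v y \<tau>) x (t - \<tau>) +
        (\<integral>\<^sup>+s\<in>{\<tau><..<t}. heat (\<lambda>y. ennpowr (v y s) p) x (t - s) \<partial>lborel)"
  obtains B where "B < \<infinity>"
    "AE \<tau> in lborel. 0 < \<tau> \<and> \<tau> < t / 2 \<longrightarrow> (AE x in lborel. heat (\<lambda>y. v y \<tau>) x (t - \<tau>) \<le> B)"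
proof
  note [measurable (raw)] = measurable_uncurry[OF v]
  \<comment> \<open>The blow-up bound at remaining time \<open>t / 2\<close>, the worst case for
    \<open>\<tau>\<close> below \<open>t / 2\<close>.\<close>
  define B where "B = (blowup_const p / (t / 2)) powr (1 / (p - 1))"
  show "ennreal B < \<infinity>" by simp
  have "2 powr (1 - p) < 1"
    using p by (auto simp: powr_less_one)
  then have c: "0 \<le> blowup_const p"
    by (auto simp: blowup_const_def intro!: divide_nonneg_nonneg)
  have "AE x in lborel. AE \<tau> in lborel. 0 < \<tau> \<and> \<tau> < t / 2 \<longrightarrow> heat (\<lambda>y. v y \<tau>) x (t - \<tau>) \<le> ennreal B"
    using sol
  proof eventually_elim
    case (elim x)
    have fin: "v x t < \<infinity>"
      using AE_lborel_ex[OF elim t] by auto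
    have "AE \<tau> in lborel. 0 < \<tau> \<and> \<tau> < t \<longrightarrow>
      heat (\<lambda>y. v y \<tau>) x (t - \<tau>) \<le> ennreal ((blowup_const p / (t - \<tau>)) powr (1 / (p - 1)))"
    proof (rule blowup_bound[OF _ p fin])
      show "(\<lambda>s. heat (\<lambda>y. ennpowr (v y s) p) x (t - s)) \<in> borel_measurable borel"
        by measurable
      show "AE \<tau> in lborel. 0 < \<tau> \<and> \<tau> < t \<longrightarrow> v x t = heat (\<lambda>y. v y \<tau>) x (t - \<tau>) +
        (\<integral>\<^sup>+s\<in>{\<tau><..<t}. heat (\<lambda>y. ennpowr (v y s) p) x (t - s) \<partial>lborel)"
        using elim by eventually_elim blast
      show "AE s in lborel. 0 < s \<and> s < t \<longrightarrow> (\<forall>a>0. ennreal a \<le> heat (\<lambda>y. v y s) x (t - s) \<longrightarrow>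
          ennreal ((a / 2) powr p) \<le> heat (\<lambda>y. ennpowr (v y s) p) x (t - s))"
        using p by (intro AE_I2 impI allI ennpowr_average_ge) (auto intro: K_mass_reflect)
    qed
    then show ?case
    proof eventually_elim
      case (elim \<tau>)
      show ?case
      proof
        assume \<tau>: "0 < \<tau> \<and> \<tau> < t / 2"
        have "(blowup_const p / (t - \<tau>)) powr (1 / (p - 1)) \<le> B"
          unfolding B_def using \<tau> p c by (intro powr_mono2 divide_left_mono divide_nonneg_nonneg) auto
        with elim \<tau> show "heat (\<lambda>y. v y \<tau>) x (t - \<tau>) \<le> ennreal B"
          by (auto intro: order_trans ennreal_leI)
      qed
    qed
  qed
  \<comment> \<open>The blow-up argument fixes \<open>x\<close>, but the mass bound needs a fixed
    \<open>\<tau>\<close>; since \<open>B\<close> depends on neither, the quantifiers can be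
    exchanged.\<close>
  then have "AE \<tau> in lborel. AE x in lborel. 0 < \<tau> \<and> \<tau> < t / 2 \<longrightarrow> heat (\<lambda>y. v y \<tau>) x (t - \<tau>) \<le> ennreal B"
    by (subst (asm) lborel_pair.AE_commute) measurable
  then show "AE \<tau> in lborel. 0 < \<tau> \<and> \<tau> < t / 2 \<longrightarrow> (AE x in lborel. heat (\<lambda>y. v y \<tau>) x (t - \<tau>) \<le> ennreal B)"
    by eventually_elim auto
qed

text \<open>With \<open>t\<close> fixed, the identity is integrated over a bounded set
  \<open>A\<close> and passed to the limit along suitable times tending to 0; varying
  \<open>A\<close> recovers the identity almost everywhere.\<close>

lemma cauchy_at_time:
  fixes v :: "'a \<Rightarrow> real \<Rightarrow> ennreal"
  assumes v: "(\<lambda>(x, t). v x t) \<in> borel_measurable borel"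
    and p: "1 < p" and t: "0 < t"
    and sol: "AE x in lborel. AE \<tau> in lborel. 0 < \<tau> \<and> \<tau> < t \<longrightarrow>
      v x t < \<infinity> \<and> v x t = heat (\<lambda>y. v y \<tau>) x (t - \<tau>) +
        (\<integral>\<^sup>+s\<in>{\<tau><..<t}. heat (\<lambda>y. ennpowr (v y s) p) x (t - s) \<partial>lborel)"
    and fin: "AE \<tau> in lborel. 0 < \<tau> \<and> \<tau> < t \<longrightarrow> (AE y in lborel. v y \<tau> < \<infinity>)"
    and \<mu>: "radon_measure \<mu>"
    and trace: "\<And>\<phi>. \<phi> \<in> C0 \<Longrightarrow>
      ess_lim_0 (\<lambda>\<tau>. \<integral>y. enn2real (v y \<tau>) * \<phi> y \<partial>lborel) (\<integral>y. \<phi> y \<partial>\<mu>)"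
  shows "AE x in lborel. v x t < \<infinity> \<and> v x t = (\<integral>\<^sup>+y. ennreal (K (x - y) t) \<partial>\<mu>) +
        (\<integral>\<^sup>+s\<in>{0<..<t}. heat (\<lambda>y. ennpowr (v y s) p) x (t - s) \<partial>lborel)"
proof -
  note [measurable (raw)] = measurable_uncurry[OF v]
  have sets_\<mu> [measurable_cong]: "sets \<mu> = sets borel" and \<mu>_fin: "compact S \<Longrightarrow> emeasure \<mu> S < \<infinity>" for S
    using \<mu> by (auto simp: radon_measure_def)
  interpret \<mu>: sigma_finite_measure \<mu>
    by (rule radon_measure_sigma_finite) fact
  interpret pair: pair_sigma_finite lborel \<mu> ..
  define D where "D \<tau> x = (\<integral>\<^sup>+s\<in>{\<tau><..<t}. heat (\<lambda>y. ennpowr (v y s) p) x (t - s) \<partial>lborel)" for \<tau> x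
  have D_meas [measurable]: "D \<tau> \<in> borel_measurable borel" for \<tau>
    unfolding D_def by measurable
  \<comment> \<open>The indicator is written as a conditional so that joint measurability, including
    the dependence on \<open>\<tau>\<close>, can be proved automatically.\<close>
  have "AE \<tau> in lborel. AE x in lborel. 0 < \<tau> \<and> \<tau> < t \<longrightarrow>
      v x t < \<infinity> \<and> v x t = heat (\<lambda>y. v y \<tau>) x (t - \<tau>) +
        (\<integral>\<^sup>+s. heat (\<lambda>y. ennpowr (v y s) p) x (t - s) * (if \<tau> < s \<and> s < t then 1 else 0) \<partial>lborel)"
    using sol unfolding indicator_def greaterThanLessThan_iff of_bool_def
    by (subst (asm) lborel_pair.AE_commute) measurable
  then have sol': "AE \<tau> in lborel. AE x in lborel. 0 < \<tau> \<and> \<tau> < t \<longrightarrow>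
      v x t < \<infinity> \<and> v x t = heat (\<lambda>y. v y \<tau>) x (t - \<tau>) + D \<tau> x"
    unfolding D_def indicator_def greaterThanLessThan_iff of_bool_def .
  obtain B where B: "B < \<infinity>"
    "AE \<tau> in lborel. 0 < \<tau> \<and> \<tau> < t / 2 \<longrightarrow> (AE x in lborel. heat (\<lambda>y. v y \<tau>) x (t - \<tau>) \<le> B)"
    using heat_average_bound[OF v p t sol] by blast
  have "AE x in lborel. v x t = (\<integral>\<^sup>+y. ennreal (K (x - y) t) \<partial>\<mu>) + D 0 x"
  proof (rule AE_lborel_eqI_bounded)
    fix A :: "'a set" assume A: "bounded A" and [measurable]: "A \<in> sets borel"
    define \<phi> where "\<phi> n y = enn2real (avg A t y) * cutoff n y" for n y
    have \<phi>_C0: "\<phi> n \<in> C0" for n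
      unfolding \<phi>_def using t by (intro avg_cutoff_in_C0) auto
    have \<phi>_nonneg: "0 \<le> \<phi> n y" for n y
      by (simp add: \<phi>_def cutoff_range)
    have \<phi>_meas [measurable]: "\<phi> n \<in> borel_measurable borel" for n
      unfolding \<phi>_def by measurable
    define conv where "conv n S \<longleftrightarrow>
        ((\<lambda>\<tau>. \<integral>y. enn2real (v y \<tau>) * \<phi> n y \<partial>lborel) \<longlongrightarrow> (\<integral>y. \<phi> n y \<partial>\<mu>)) (at 0 within S)" for n S
    have "\<exists>E. E \<in> null_sets lebesgue \<and> conv n ({0<..} - E)" for n
      using trace[OF \<phi>_C0[of n]] unfolding ess_lim_0_def conv_def by blast
    then obtain E where E: "\<And>n. E n \<in> null_sets lebesgue"
      "\<And>n. conv n ({0<..} - E n)"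
      by metis
    \<comment> \<open>For given \<open>A\<close> only countably many test functions occur, so their
      exceptional null sets can be avoided simultaneously.\<close>
    have E_AE: "AE \<tau> in lborel. \<forall>n. \<tau> \<notin> E n"
      unfolding AE_all_countable using AE_not_in[OF E(1)] by (simp add: AE_completion_iff)
    define good where "good \<tau> \<longleftrightarrow> (\<forall>n. \<tau> \<notin> E n) \<and>
      (AE x in lborel. v x t = heat (\<lambda>y. v y \<tau>) x (t - \<tau>) + D \<tau> x) \<and>
      (AE x in lborel. heat (\<lambda>y. v y \<tau>) x (t - \<tau>) \<le> B) \<and> (AE y in lborel. v y \<tau> < \<infinity>)" for \<tau>
    have "AE \<tau> in lborel. 0 < \<tau> \<and> \<tau> < t / 2 \<longrightarrow> good \<tau>"
      using E_AE sol' B(2) fin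
    proof eventually_elim
      case (elim \<tau>)
      show ?case
      proof
        assume \<tau>: "0 < \<tau> \<and> \<tau> < t / 2"
        with elim(2) have "AE x in lborel. v x t = heat (\<lambda>y. v y \<tau>) x (t - \<tau>) + D \<tau> x"
          using t by auto
        with elim \<tau> t show "good \<tau>"
          by (auto simp: good_def)
      qed
    qed
    \<comment> \<open>Picking one good time from each of these consecutive disjoint intervals makes
      the sequence decreasing with limit 0 and keeps it below \<open>t / 2\<close>.\<close>
    then have "\<exists>\<tau>. t / 2 / real (k + 2) < \<tau> \<and> \<tau> < t / 2 / real (k + 1) \<and> (0 < \<tau> \<and> \<tau> < t / 2 \<longrightarrow> good \<tau>)" for k
      using t by (intro AE_lborel_ex divide_strict_left_mono) auto
    then obtain \<tau> where \<tau>: "\<And>k. t / 2 / real (k + 2) < \<tau> k" "\<And>k. \<tau> k < t / 2 / real (k + 1)"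
      "\<And>k. 0 < \<tau> k \<and> \<tau> k < t / 2 \<longrightarrow> good (\<tau> k)"
      by metis
    have \<tau>_pos: "0 < \<tau> k" for k
      using t by (intro less_trans[OF _ \<tau>(1)[of k]]) simp
    have "t / 2 / real (k + 1) \<le> t / 2" for k
      using t by (simp add: field_simps)
    then have \<tau>_less: "\<tau> k < t / 2" for k
      using \<tau>(2)[of k] by (rule less_le_trans[rotated])
    have good: "good (\<tau> k)" for k
      using \<tau>(3) \<tau>_pos \<tau>_less by blast
    have "\<tau> (Suc k) \<le> \<tau> k" for k
    proof -
      have "Suc k + 1 = k + 2" by simp
      with \<tau>(2)[of "Suc k"] \<tau>(1)[of k] show ?thesis
        by (metis less_imp_le less_trans)
    qed
    then have \<tau>_dec: "decseq \<tau>"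
      by (rule decseq_SucI)
    have "(\<lambda>k. t / 2 / real (k + 1)) \<longlonglongrightarrow> 0"
      using tendsto_mult_left[OF LIMSEQ_inverse_real_of_nat, of "t / 2"] by (simp add: field_simps)
    then have \<tau>_lim: "\<tau> \<longlonglongrightarrow> 0"
      by (rule tendsto_sandwich[OF _ _ tendsto_const, rotated 2])
        (intro always_eventually allI less_imp_le \<tau>_pos \<tau>(2))+
    obtain C where C: "C < \<infinity>" "\<And>k z. (\<integral>\<^sup>+y. indicator A (y + z) * v y (\<tau> k) \<partial>lborel) \<le> C"
    proof (rule local_mass_bound[OF t A _ B(1)])
      fix C assume C: "C < \<infinity>" "\<And>s w z. t / 2 \<le> s \<Longrightarrow> s \<le> t \<Longrightarrow> w \<in> borel_measurable borel \<Longrightarrow>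
        (AE x in lborel. heat w x s \<le> B) \<Longrightarrow> (\<integral>\<^sup>+y. indicator A (y + z) * w y \<partial>lborel) \<le> C"
      show thesis
        by (rule that[OF C(1)], rule C(2)[of "t - \<tau> k" for k])
          (use \<tau>_pos \<tau>_less good in \<open>auto simp: good_def less_imp_le field_simps\<close>)
    qed measurable
    \<comment> \<open>Finite mass on balls makes the Bochner integrals of the trace hypothesis
      genuine at the chosen times, so they agree with the nonnegative integrals.\<close>
    have ball_fin: "(\<integral>\<^sup>+y. indicator (cball 0 r) y * v y (\<tau> k) \<partial>lborel) < \<infinity>" for k r
    proof (rule local_mass_bound[OF t _ _ B(1), of "cball 0 r"])
      fix C assume C: "C < \<infinity>" "\<And>s w z. t / 2 \<le> s \<Longrightarrow> s \<le> t \<Longrightarrow> w \<in> borel_measurable borel \<Longrightarrow>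
        (AE x in lborel. heat w x s \<le> B) \<Longrightarrow> (\<integral>\<^sup>+y. indicator (cball 0 r) (y + z) * w y \<partial>lborel) \<le> C"
      have "(\<integral>\<^sup>+y. indicator (cball 0 r) (y + 0) * v y (\<tau> k) \<partial>lborel) \<le> C"
        by (rule C(2)[of "t - \<tau> k"]) (use \<tau>_pos[of k] \<tau>_less[of k] good[of k] in \<open>auto simp: good_def field_simps\<close>)
      with C(1) show "(\<integral>\<^sup>+y. indicator (cball 0 r) y * v y (\<tau> k) \<partial>lborel) < \<infinity>"
        by simp
    qed auto
    have \<phi>_ennreal: "ennreal (\<phi> n y) = avg A t y * ennreal (cutoff n y)" for n y
      unfolding \<phi>_def by (rule avg_cutoff[OF t])
    have \<phi>_le: "ennreal (\<phi> n y) \<le> indicator (cball 0 (real n + 1)) y" for n y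
      unfolding \<phi>_ennreal by (rule avg_cutoff[OF t])
    have lim: "(\<lambda>k. \<integral>\<^sup>+y. avg A t y * ennreal (cutoff n y) * v y (\<tau> k) \<partial>lborel) \<longlonglongrightarrow>
      (\<integral>\<^sup>+y. avg A t y * ennreal (cutoff n y) \<partial>\<mu>)" for n
    proof -
      have "(\<integral>\<^sup>+y. ennreal (\<phi> n y) \<partial>\<mu>) \<le> (\<integral>\<^sup>+y. indicator (cball 0 (real n + 1)) y \<partial>\<mu>)"
        by (intro nn_integral_mono \<phi>_le)
      also have "\<dots> < \<infinity>"
        using \<mu>_fin[of "cball 0 (real n + 1)"] by (simp add: sets_\<mu>)
      finally have "(\<integral>\<^sup>+y. ennreal (\<phi> n y) \<partial>\<mu>) < \<infinity>" .
      then have "integrable \<mu> (\<phi> n)"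
        by (intro integrableI_nonneg) (auto simp: \<phi>_nonneg)
      then have \<mu>_eq: "(\<integral>\<^sup>+y. ennreal (\<phi> n y) \<partial>\<mu>) = ennreal (\<integral>y. \<phi> n y \<partial>\<mu>)"
        by (intro nn_integral_eq_integral) (auto simp: \<phi>_nonneg)
      have v_eq: "(\<integral>\<^sup>+y. ennreal (\<phi> n y) * v y (\<tau> k) \<partial>lborel) = ennreal (\<integral>y. enn2real (v y (\<tau> k)) * \<phi> n y \<partial>lborel)" for k
      proof -
        have "AE y in lborel. v y (\<tau> k) < \<infinity>"
          using good by (auto simp: good_def)
        then have eq: "(\<integral>\<^sup>+y. ennreal (\<phi> n y) * v y (\<tau> k) \<partial>lborel) =
            (\<integral>\<^sup>+y. ennreal (enn2real (v y (\<tau> k)) * \<phi> n y) \<partial>lborel)"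
          by (intro nn_integral_cong_AE) (auto elim!: eventually_mono simp: ennreal_mult \<phi>_nonneg mult.commute ennreal_enn2real_if)
        have "(\<integral>\<^sup>+y. ennreal (\<phi> n y) * v y (\<tau> k) \<partial>lborel) \<le> (\<integral>\<^sup>+y. indicator (cball 0 (real n + 1)) y * v y (\<tau> k) \<partial>lborel)"
          by (intro nn_integral_mono mult_right_mono \<phi>_le) auto
        also note ball_fin
        finally have "integrable lborel (\<lambda>y. enn2real (v y (\<tau> k)) * \<phi> n y)"
          unfolding eq by (intro integrableI_nonneg) (auto simp: \<phi>_nonneg)
        then show ?thesis
          unfolding eq by (intro nn_integral_eq_integral) (auto simp: \<phi>_nonneg)
      qed
      have "\<forall>k. \<tau> k \<in> {0<..} - E n - {0}"
        using \<tau>_pos good by (force simp: good_def)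
      then have "(\<lambda>k. \<integral>y. enn2real (v y (\<tau> k)) * \<phi> n y \<partial>lborel) \<longlonglongrightarrow> (\<integral>y. \<phi> n y \<partial>\<mu>)"
        using E(2)[of n] \<tau>_lim unfolding conv_def tendsto_at_iff_sequentially comp_def by blast
      then show ?thesis
        unfolding \<phi>_ennreal[symmetric] v_eq \<mu>_eq by (rule tendsto_ennrealI)
    qed
    have s_lim: "(\<lambda>k. t - \<tau> k) \<longlonglongrightarrow> t"
      using tendsto_diff[OF tendsto_const \<tau>_lim, of t] by simp
    have "(\<lambda>k. \<integral>\<^sup>+y. avg A (t - \<tau> k) y * v y (\<tau> k) \<partial>lborel) \<longlonglongrightarrow> (\<integral>\<^sup>+y. avg A t y \<partial>\<mu>)"
    proof (rule tendsto_avg_integral[OF t _ s_lim A _ _ sets_\<mu> C lim])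
      show "0 < t - \<tau> k" for k
        using \<tau>_less[of k] \<tau>_pos[of k] by linarith
    qed measurable
    moreover have "(\<integral>\<^sup>+y. avg A (t - \<tau> k) y * v y (\<tau> k) \<partial>lborel) =
        (\<integral>\<^sup>+x. indicator A x * heat (\<lambda>y. v y (\<tau> k)) x (t - \<tau> k) \<partial>lborel)" for k
    proof -
      have "(\<integral>\<^sup>+y. avg A (t - \<tau> k) y * v y (\<tau> k) \<partial>lborel) =
          (\<integral>\<^sup>+y. (\<integral>\<^sup>+x. indicator A x * ennreal (K (x - y) (t - \<tau> k)) * v y (\<tau> k) \<partial>lborel) \<partial>lborel)"
        unfolding avg_def by (intro nn_integral_cong nn_integral_multc[symmetric]) measurable
      also have "\<dots> = (\<integral>\<^sup>+x. (\<integral>\<^sup>+y. indicator A x * ennreal (K (x - y) (t - \<tau> k)) * v y (\<tau> k) \<partial>lborel) \<partial>lborel)"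
        by (rule lborel_pair.Fubini') measurable
      also have "\<dots> = (\<integral>\<^sup>+x. indicator A x * heat (\<lambda>y. v y (\<tau> k)) x (t - \<tau> k) \<partial>lborel)"
        unfolding mult.assoc by (intro nn_integral_cong nn_integral_cmult) measurable
      finally show ?thesis .
    qed
    moreover have "(\<integral>\<^sup>+y. avg A t y \<partial>\<mu>) = (\<integral>\<^sup>+x. indicator A x * (\<integral>\<^sup>+y. ennreal (K (x - y) t) \<partial>\<mu>) \<partial>lborel)"
    proof -
      have "(\<integral>\<^sup>+y. avg A t y \<partial>\<mu>) = (\<integral>\<^sup>+x. (\<integral>\<^sup>+y. indicator A x * ennreal (K (x - y) t) \<partial>\<mu>) \<partial>lborel)"
        unfolding avg_def by (rule pair.Fubini') measurable
      also have "\<dots> = (\<integral>\<^sup>+x. indicator A x * (\<integral>\<^sup>+y. ennreal (K (x - y) t) \<partial>\<mu>) \<partial>lborel)"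
        by (intro nn_integral_cong nn_integral_cmult) measurable
      finally show ?thesis .
    qed
    ultimately have H_lim: "(\<lambda>k. \<integral>\<^sup>+x. indicator A x * heat (\<lambda>y. v y (\<tau> k)) x (t - \<tau> k) \<partial>lborel) \<longlonglongrightarrow>
        (\<integral>\<^sup>+x. indicator A x * (\<integral>\<^sup>+y. ennreal (K (x - y) t) \<partial>\<mu>) \<partial>lborel)"
      by simp
    have D_inc: "incseq (\<lambda>k x. indicator A x * D (\<tau> k) x)"
      using decseqD[OF \<tau>_dec] unfolding D_def incseq_def le_fun_def
      by (intro allI impI mult_left_mono nn_integral_mono) (fastforce simp: indicator_def)+
    \<comment> \<open>The intervals \<open>{\<tau> k<..<t}\<close> increase to
      \<open>{0<..<t}\<close>, so monotone convergence applies even to an infinite Duhamel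
      term.\<close>
    have D_SUP: "D 0 x = (SUP k. D (\<tau> k) x)" for x
    proof -
      let ?q = "\<lambda>s. heat (\<lambda>y. ennpowr (v y s) p) x (t - s)"
      have "(SUP k. ?q s * indicator {\<tau> k<..<t} s) = ?q s * indicator {0<..<t} s" for s
      proof (rule antisym)
        show "(SUP k. ?q s * indicator {\<tau> k<..<t} s) \<le> ?q s * indicator {0<..<t} s"
          using \<tau>_pos by (intro SUP_least mult_left_mono) (auto simp: indicator_def intro: less_trans)
        show "?q s * indicator {0<..<t} s \<le> (SUP k. ?q s * indicator {\<tau> k<..<t} s)"
        proof (cases "s \<in> {0<..<t}")
          case True
          then have "\<forall>\<^sub>F k in sequentially. \<tau> k < s"
            using \<tau>_lim by (intro order_tendstoD(2)) auto
          then obtain k where "\<tau> k < s"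
            using eventually_happens'[OF sequentially_bot] by blast
          with True show ?thesis
            by (intro SUP_upper2[of k]) auto
        qed simp
      qed
      then have "D 0 x = (\<integral>\<^sup>+s. (SUP k. ?q s * indicator {\<tau> k<..<t} s) \<partial>lborel)"
        by (simp add: D_def)
      also have "\<dots> = (SUP k. D (\<tau> k) x)"
        unfolding D_def
      proof (rule nn_integral_monotone_convergence_SUP)
        show "incseq (\<lambda>k s. ?q s * indicator {\<tau> k<..<t} s)"
          using decseqD[OF \<tau>_dec] unfolding incseq_def le_fun_def
          by (intro allI impI mult_left_mono) (fastforce simp: indicator_def)+
      qed measurable
      finally show ?thesis .
    qed
    have "(\<integral>\<^sup>+x. indicator A x * D 0 x \<partial>lborel) = (\<integral>\<^sup>+x. (SUP k. indicator A x * D (\<tau> k) x) \<partial>lborel)"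
      by (simp add: D_SUP SUP_mult_left_ennreal)
    also have "\<dots> = (SUP k. \<integral>\<^sup>+x. indicator A x * D (\<tau> k) x \<partial>lborel)"
      by (rule nn_integral_monotone_convergence_SUP[OF D_inc]) measurable
    finally have "(\<lambda>k. \<integral>\<^sup>+x. indicator A x * D (\<tau> k) x \<partial>lborel) \<longlonglongrightarrow> (\<integral>\<^sup>+x. indicator A x * D 0 x \<partial>lborel)"
      using LIMSEQ_SUP[of "\<lambda>k. \<integral>\<^sup>+x. indicator A x * D (\<tau> k) x \<partial>lborel"] D_inc
      by (auto simp: incseq_def le_fun_def intro!: nn_integral_mono)
    from tendsto_add[OF H_lim this]
    have "(\<lambda>k. (\<integral>\<^sup>+x. indicator A x * heat (\<lambda>y. v y (\<tau> k)) x (t - \<tau> k) \<partial>lborel) +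
        (\<integral>\<^sup>+x. indicator A x * D (\<tau> k) x \<partial>lborel)) \<longlonglongrightarrow>
        (\<integral>\<^sup>+x. indicator A x * (\<integral>\<^sup>+y. ennreal (K (x - y) t) \<partial>\<mu>) \<partial>lborel) + (\<integral>\<^sup>+x. indicator A x * D 0 x \<partial>lborel)" .
    \<comment> \<open>By the solution identity this sum does not depend on \<open>k\<close>, so it
      equals the limit just computed.\<close>
    moreover have "(\<integral>\<^sup>+x. indicator A x * heat (\<lambda>y. v y (\<tau> k)) x (t - \<tau> k) \<partial>lborel) +
        (\<integral>\<^sup>+x. indicator A x * D (\<tau> k) x \<partial>lborel) = (\<integral>\<^sup>+x. indicator A x * v x t \<partial>lborel)" for k
    proof -
      have "(\<integral>\<^sup>+x. indicator A x * heat (\<lambda>y. v y (\<tau> k)) x (t - \<tau> k) \<partial>lborel) +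
        (\<integral>\<^sup>+x. indicator A x * D (\<tau> k) x \<partial>lborel) =
        (\<integral>\<^sup>+x. indicator A x * heat (\<lambda>y. v y (\<tau> k)) x (t - \<tau> k) + indicator A x * D (\<tau> k) x \<partial>lborel)"
        by (rule nn_integral_add[symmetric]) measurable
      also have "\<dots> = (\<integral>\<^sup>+x. indicator A x * v x t \<partial>lborel)"
      proof (rule nn_integral_cong_AE)
        have "AE x in lborel. v x t = heat (\<lambda>y. v y (\<tau> k)) x (t - \<tau> k) + D (\<tau> k) x"
          using good by (auto simp: good_def)
        then show "AE x in lborel. indicator A x * heat (\<lambda>y. v y (\<tau> k)) x (t - \<tau> k) + indicator A x * D (\<tau> k) x =
            indicator A x * v x t"
          by eventually_elim (simp add: distrib_left)
      qed
      finally show ?thesis .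
    qed
    ultimately have "(\<integral>\<^sup>+x. indicator A x * v x t \<partial>lborel) =
        (\<integral>\<^sup>+x. indicator A x * (\<integral>\<^sup>+y. ennreal (K (x - y) t) \<partial>\<mu>) \<partial>lborel) + (\<integral>\<^sup>+x. indicator A x * D 0 x \<partial>lborel)"
      by (simp add: LIMSEQ_const_iff)
    also have "\<dots> = (\<integral>\<^sup>+x. indicator A x * (\<integral>\<^sup>+y. ennreal (K (x - y) t) \<partial>\<mu>) + indicator A x * D 0 x \<partial>lborel)"
      by (rule nn_integral_add[symmetric]) measurable
    finally show "(\<integral>\<^sup>+x. indicator A x * v x t \<partial>lborel) =
        (\<integral>\<^sup>+x. indicator A x * ((\<integral>\<^sup>+y. ennreal (K (x - y) t) \<partial>\<mu>) + D 0 x) \<partial>lborel)"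
      by (simp add: distrib_left)
  qed measurable
  moreover have "AE x in lborel. v x t < \<infinity>"
    using sol
  proof eventually_elim
    case (elim x)
    then show ?case
      using AE_lborel_ex[OF elim t] by auto
  qed
  ultimately show ?thesis
    unfolding D_def by eventually_elim simp
qed

end

section \<open>From the fundamental solution and a measurable solution to kernels and Borel
  functions\<close>

lemma fundamental_solution_positive_kernel:
  fixes G :: "'a::euclidean_space \<Rightarrow> real \<Rightarrow> real"
  assumes G: "fundamental_solution \<theta> G"
  shows "positive_kernel (\<lambda>x t. if 0 < t then G x t else 0)"
proof
  have pos: "0 < G x t" if "0 < t" for x t
    using G that by (auto simp: fundamental_solution_def)
  have "Ck_on 0 (UNIV \<times> {0<..}) (\<lambda>(x, t). G x t)"
    using G unfolding fundamental_solution_def smooth_on_def by blast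
  then have cont: "continuous_on (UNIV \<times> {0<..}) (\<lambda>(x, t). G x t)"
    by simp
  \<comment> \<open>Setting the kernel to 0 for \<open>t \<le> 0\<close> discards the arbitrary
    values of \<open>G\<close> there and gives a Borel function on all of space-time.\<close>
  have eq: "(\<lambda>(x, t). if 0 < t then G x t else 0) =
      (\<lambda>z. if z \<in> UNIV \<times> {0<..} then (\<lambda>(x, t). G x t) z else 0)"
    by auto
  have "open (UNIV \<times> {0<..} :: ('a \<times> real) set)"
    by (intro open_Times) auto
  then show meas: "(\<lambda>(x, t). if 0 < t then G x t else 0) \<in> borel_measurable borel"
    unfolding eq by (intro borel_measurable_continuous_on_if cont) auto
  show "continuous_on (UNIV \<times> {0<..}) (\<lambda>(x, t). if 0 < t then G x t else 0)"
    by (rule continuous_on_eq[OF cont]) auto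
  show "0 < (if 0 < t then G x t else 0)" if "0 < t" for x t
    using that pos by simp
  show "(\<integral>\<^sup>+x. ennreal (if 0 < t then G x t else 0) \<partial>lborel) = 1" if t: "0 < t" for t
  proof -
    \<comment> \<open>At frequency 0 the transform is the total mass. Its value 1 also forces
      integrability, because a non-integrable function has Bochner integral 0.\<close>
    have "(\<integral>x. complex_of_real (G x t) * exp (- (\<i> * complex_of_real (0 \<bullet> x))) \<partial>lebesgue) =
        complex_of_real (exp (- t * norm (0 :: 'a) powr \<theta>))"
      using G t unfolding fundamental_solution_def by blast
    then have int: "(\<integral>x. complex_of_real (G x t) \<partial>lebesgue) = 1"
      by simp
    then have "integrable lebesgue (\<lambda>x. complex_of_real (G x t))"
      using not_integrable_integral_eq by force
    then have "integrable lebesgue (\<lambda>x. G x t)"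
      by (simp add: complex_of_real_integrable_eq)
    then have "(\<integral>\<^sup>+x. ennreal (G x t) \<partial>lebesgue) = ennreal (\<integral>x. G x t \<partial>lebesgue)"
      using pos[OF t] by (intro nn_integral_eq_integral) (auto intro: less_imp_le)
    also have "(\<integral>x. G x t \<partial>lebesgue) = 1"
      using int by simp
    finally show ?thesis
      using t by (simp add: nn_integral_completion)
  qed
qed

text \<open>Lebesgue measurability on the product is not inherited by every slice; a Borel version
  makes Tonelli and automatic measurability proofs available.\<close>

lemma measurable_upto_borel_version:
  fixes u :: "'a::euclidean_space \<Rightarrow> real \<Rightarrow> ennreal"
  assumes "measurable_upto T u"
  obtains v where "(\<lambda>(x, t). v x t) \<in> borel_measurable borel"
    "AE (x, t) in lborel. 0 < t \<and> t < T \<longrightarrow> u x t = v x t"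
proof -
  let ?S = "UNIV \<times> {0<..<T} :: ('a \<times> real) set"
  have "open ?S"
    by (intro open_Times) auto
  then have "?S \<inter> space lebesgue \<in> sets lebesgue"
    by simp
  then have "(\<lambda>z. if z \<in> ?S then (\<lambda>(x, t). u x t) z else 0) \<in> borel_measurable lebesgue"
    using assms unfolding measurable_upto_def by (subst (asm) measurable_restrict_space_iff) auto
  then obtain v where v: "v \<in> borel_measurable lborel"
    "AE z in lborel. (if z \<in> ?S then (\<lambda>(x, t). u x t) z else 0) = v z"
    using completion_ex_borel_measurable by blast
  show ?thesis
  proof (rule that[of "\<lambda>x t. v (x, t)"])
    show "(\<lambda>(x, t). v (x, t)) \<in> borel_measurable borel"
      using v(1) by simp
    show "AE (x, t) in lborel. 0 < t \<and> t < T \<longrightarrow> u x t = v (x, t)"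
      using v(2) by eventually_elim (auto split: prod.split)
  qed
qed

lemma AE_lborel_pair:
  assumes "AE z in (lborel :: ('a::euclidean_space \<times> 'b::euclidean_space) measure). P z"
  shows "AE x in lborel. AE y in lborel. P (x, y)" "AE y in lborel. AE x in lborel. P (x, y)"
  using assms unfolding lborel_prod[symmetric]
  by (auto intro: lborel_pair.AE_pair lborel_pair.AE_pair_swap)

section \<open>Transfer to the Borel version and assembly over all times\<close>

theorem theorem1p2:
  fixes G :: "'a::euclidean_space \<Rightarrow> real \<Rightarrow> real"
    and u :: "'a \<Rightarrow> real \<Rightarrow> ennreal"
    and \<mu> :: "'a measure"
    and \<theta> p T :: real
  assumes "0 < \<theta>" and "\<theta> \<le> 2" and "1 < p" and "0 < T"
    and "fundamental_solution \<theta> G"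
    and "is_solution G p T u"
    and "radon_measure \<mu>"
    and "initial_trace u \<mu>"
  shows "is_cauchy_solution G p T \<mu> u"
proof -
  define K where "K x t = (if 0 < t then G x t else 0)" for x t
  have K_eq: "K x t = G x t" if "0 < t" for x t
    using that by (simp add: K_def)
  interpret positive_kernel K
    unfolding K_def using assms(5) by (rule fundamental_solution_positive_kernel)
  have meas_u: "measurable_upto T u"
    using assms(6) by (simp add: is_solution_def)
  obtain v where v: "(\<lambda>(x, t). v x t) \<in> borel_measurable borel"
    and uv: "AE (x, t) in lborel. 0 < t \<and> t < T \<longrightarrow> u x t = v x t"
    using measurable_upto_borel_version[OF meas_u] .
  note [measurable (raw)] = measurable_uncurry[OF v]
  interpret \<mu>: sigma_finite_measure \<mu>
    by (rule radon_measure_sigma_finite) fact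
  have sets_\<mu> [measurable_cong]: "sets \<mu> = sets borel"
    using assms(7) by (auto simp: radon_measure_def)
  have uv_t: "AE t in lborel. 0 < t \<and> t < T \<longrightarrow> (AE x in lborel. u x t = v x t)"
    using AE_lborel_pair(2)[OF uv] by eventually_elim auto

  define D where "D \<tau> x t = (\<integral>\<^sup>+s\<in>{\<tau><..<t}. heat (\<lambda>y. ennpowr (v y s) p) x (t - s) \<partial>lborel)" for \<tau> x t
  \<comment> \<open>Valid without exceptional points \<open>x\<close>, \<open>\<tau>\<close>,
    \<open>t\<close>: changing \<open>u\<close> on a null set of times \<open>s\<close>, and on null
    sets of \<open>y\<close> at the others, leaves the iterated integral unchanged.\<close>
  have duhamel_eq: "duhamel G p u \<tau> x t = D \<tau> x t" if "0 \<le> \<tau>" "t \<le> T" for \<tau> x t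
    unfolding duhamel_def D_def nn_integral_completion
  proof (rule nn_integral_cong_AE)
    show "AE s in lborel. (\<integral>\<^sup>+y. ennreal (G (x - y) (t - s)) * ennpowr (u y s) p \<partial>lborel) * indicator {\<tau><..<t} s =
        heat (\<lambda>y. ennpowr (v y s) p) x (t - s) * indicator {\<tau><..<t} s"
      using uv_t
    proof eventually_elim
      case (elim s)
      show ?case
      proof (cases "s \<in> {\<tau><..<t}")
        case True
        with elim that have "AE y in lborel. u y s = v y s"
          by auto
        then have "AE y in lborel. ennreal (G (x - y) (t - s)) * ennpowr (u y s) p =
            ennreal (K (x - y) (t - s)) * ennpowr (v y s) p"
          by eventually_elim (use True in \<open>simp add: K_eq\<close>)
        then show ?thesis
          by (simp cong: nn_integral_cong_AE)
      qed simp
    qed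
  qed

  have "AE z in lborel. \<forall>x \<tau> t. z = (x, \<tau>, t) \<longrightarrow> 0 < \<tau> \<and> \<tau> < t \<and> t < T \<longrightarrow> u x t < \<infinity> \<and>
      u x t = (\<integral>\<^sup>+y. ennreal (G (x - y) (t - \<tau>)) * u y \<tau> \<partial>lborel) + duhamel G p u \<tau> x t"
    using assms(6) unfolding is_solution_def AE_completion_iff nn_integral_completion
    by (auto elim!: eventually_mono)
  \<comment> \<open>Splitting twice puts \<open>t\<close> outermost and \<open>x\<close> innermost,
    so that \<open>u\<close> can be replaced by \<open>v\<close> slice by slice.\<close>
  from AE_lborel_pair(2)[OF AE_lborel_pair(2)[OF this]]
  have "AE t in lborel. AE \<tau> in lborel. AE x in lborel. 0 < \<tau> \<and> \<tau> < t \<and> t < T \<longrightarrow> u x t < \<infinity> \<and>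
      u x t = (\<integral>\<^sup>+y. ennreal (G (x - y) (t - \<tau>)) * u y \<tau> \<partial>lborel) + duhamel G p u \<tau> x t"
    by simp
  then have sol: "AE t in lborel. 0 < t \<and> t < T \<longrightarrow> (AE \<tau> in lborel. AE x in lborel. 0 < \<tau> \<and> \<tau> < t \<longrightarrow>
      v x t < \<infinity> \<and> v x t = heat (\<lambda>y. v y \<tau>) x (t - \<tau>) + D \<tau> x t)"
    using uv_t
  proof eventually_elim
    case t: (elim t)
    show ?case
    proof
      assume tT: "0 < t \<and> t < T"
      with t have uv_x: "AE x in lborel. u x t = v x t" by auto
      show "AE \<tau> in lborel. AE x in lborel. 0 < \<tau> \<and> \<tau> < t \<longrightarrow>
          v x t < \<infinity> \<and> v x t = heat (\<lambda>y. v y \<tau>) x (t - \<tau>) + D \<tau> x t"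
        using t(1) uv_t
      proof eventually_elim
        case \<tau>: (elim \<tau>)
        show ?case
        proof (cases "0 < \<tau> \<and> \<tau> < t")
          case True
          with \<tau> tT have uv_y: "AE y in lborel. u y \<tau> = v y \<tau>" by auto
          have "(\<integral>\<^sup>+y. ennreal (G (x - y) (t - \<tau>)) * u y \<tau> \<partial>lborel) = heat (\<lambda>y. v y \<tau>) x (t - \<tau>)" for x
          proof (rule nn_integral_cong_AE)
            show "AE y in lborel. ennreal (G (x - y) (t - \<tau>)) * u y \<tau> = ennreal (K (x - y) (t - \<tau>)) * v y \<tau>"
              using uv_y by eventually_elim (use True in \<open>simp add: K_eq\<close>)
          qed
          note heat_eq = this
          from \<tau>(1) uv_x show ?thesis
          proof eventually_elim
            case (elim x)
            have D: "duhamel G p u \<tau> x t = D \<tau> x t"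
              using True tT by (intro duhamel_eq) auto
            from elim(1) True tT show ?case
              unfolding heat_eq D elim(2) by blast
          qed
        qed auto
      qed
    qed
  qed
  have fin: "AE t in lborel. 0 < t \<and> t < T \<longrightarrow> (AE y in lborel. v y t < \<infinity>)"
    using sol
  proof eventually_elim
    case (elim t)
    show ?case
    proof
      assume t: "0 < t \<and> t < T"
      with elim obtain \<tau> where "0 < \<tau>" "\<tau> < t" "AE x in lborel. 0 < \<tau> \<and> \<tau> < t \<longrightarrow>
          v x t < \<infinity> \<and> v x t = heat (\<lambda>y. v y \<tau>) x (t - \<tau>) + D \<tau> x t"
        using AE_lborel_ex[of _ 0 t] by blast
      then show "AE y in lborel. v y t < \<infinity>"
        by auto
    qed
  qed

  have trace: "ess_lim_0 (\<lambda>\<tau>. \<integral>y. enn2real (v y \<tau>) * \<phi> y \<partial>lborel) (\<integral>y. \<phi> y \<partial>\<mu>)" if \<phi>: "\<phi> \<in> C0" for \<phi>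
  proof -
    have [measurable]: "\<phi> \<in> borel_measurable borel"
      using \<phi> by (intro borel_measurable_continuous_onI) (simp add: C0_def)
    obtain E where E: "E \<in> null_sets lebesgue"
      "((\<lambda>t. \<integral>y. enn2real (u y t) * \<phi> y \<partial>lebesgue) \<longlongrightarrow> (\<integral>y. \<phi> y \<partial>\<mu>)) (at 0 within ({0<..} - E))"
      using assms(8) \<phi> unfolding initial_trace_def ess_lim_0_def by blast
    obtain E' where E'_null: "E' \<in> null_sets lborel"
      and "{t \<in> space lborel. \<not> (0 < t \<and> t < T \<longrightarrow> (AE x in lborel. u x t = v x t))} \<subseteq> E'"
      using iffD1[OF eventually_ae_filter uv_t] by blast
    then have E'_uv: "AE x in lborel. u x t = v x t" if "t \<notin> E'" "0 < t" "t < T" for t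
      using that by auto
    have eq: "(\<integral>y. enn2real (u y t) * \<phi> y \<partial>lebesgue) = (\<integral>y. enn2real (v y t) * \<phi> y \<partial>lborel)"
      if "t \<notin> E'" "0 < t" "t < T" for t
    proof -
      have meas: "(\<lambda>y. enn2real (v y t) * \<phi> y) \<in> borel_measurable lborel"
        by measurable
      have ae: "AE y in lebesgue. enn2real (v y t) * \<phi> y = enn2real (u y t) * \<phi> y"
        using E'_uv[OF that] unfolding AE_completion_iff by eventually_elim simp
      \<comment> \<open>Measurability of this slice of \<open>u\<close> is inherited from its almost
        everywhere agreement with the Borel slice of \<open>v\<close>.\<close>
      have "(\<integral>y. enn2real (v y t) * \<phi> y \<partial>lebesgue) = (\<integral>y. enn2real (u y t) * \<phi> y \<partial>lebesgue)"
        using ae measurable_completion[OF meas] by (intro integral_cong_AE borel_measurable_AE[OF _ ae])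
      then show ?thesis
        using integral_completion[OF meas] by simp
    qed
    have "E \<union> E' \<in> null_sets lebesgue"
      using E(1) null_sets_completionI[OF E'_null] by (rule null_sets.Un)
    moreover have "((\<lambda>t. \<integral>y. enn2real (v y t) * \<phi> y \<partial>lborel) \<longlongrightarrow> (\<integral>y. \<phi> y \<partial>\<mu>)) (at 0 within ({0<..} - (E \<union> E')))"
    proof (rule Lim_transform_eventually)
      show "((\<lambda>t. \<integral>y. enn2real (u y t) * \<phi> y \<partial>lebesgue) \<longlongrightarrow> (\<integral>y. \<phi> y \<partial>\<mu>)) (at 0 within ({0<..} - (E \<union> E')))"
        by (rule tendsto_within_subset[OF E(2)]) auto
      have "\<forall>\<^sub>F t in nhds 0. t < T"
        using \<open>0 < T\<close> eventually_nhds_in_open[of "{..<T}" 0] by auto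
      then show "\<forall>\<^sub>F t in at 0 within ({0<..} - (E \<union> E')).
          (\<integral>y. enn2real (u y t) * \<phi> y \<partial>lebesgue) = (\<integral>y. enn2real (v y t) * \<phi> y \<partial>lborel)"
        unfolding eventually_at_filter by eventually_elim (auto simp: eq)
    qed
    ultimately show ?thesis
      unfolding ess_lim_0_def by blast
  qed

  define W where "W x t \<longleftrightarrow> (0 < t \<and> t < T \<longrightarrow> v x t < \<infinity> \<and>
      v x t = (\<integral>\<^sup>+y. ennreal (K (x - y) t) \<partial>\<mu>) + D 0 x t)" for x t
  have "AE t in lborel. AE x in lborel. W x t"
    using sol
  proof eventually_elim
    case (elim t)
    show ?case
    proof (cases "0 < t \<and> t < T")
      case True
      with elim have "AE \<tau> in lborel. AE x in lborel. 0 < \<tau> \<and> \<tau> < t \<longrightarrow>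
          v x t < \<infinity> \<and> v x t = heat (\<lambda>y. v y \<tau>) x (t - \<tau>) + D \<tau> x t"
        by auto
      then have "AE x in lborel. AE \<tau> in lborel. 0 < \<tau> \<and> \<tau> < t \<longrightarrow>
          v x t < \<infinity> \<and> v x t = heat (\<lambda>y. v y \<tau>) x (t - \<tau>) + D \<tau> x t"
        unfolding D_def indicator_def greaterThanLessThan_iff of_bool_def
        by (subst lborel_pair.AE_commute) measurable
      moreover have "AE \<tau> in lborel. 0 < \<tau> \<and> \<tau> < t \<longrightarrow> (AE y in lborel. v y \<tau> < \<infinity>)"
        using fin by eventually_elim (use True in auto)
      ultimately have "AE x in lborel. v x t < \<infinity> \<and> v x t = (\<integral>\<^sup>+y. ennreal (K (x - y) t) \<partial>\<mu>) + D 0 x t"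
        unfolding D_def using True by (intro cauchy_at_time[OF v \<open>1 < p\<close> _ _ _ assms(7) trace]) auto
      then show ?thesis
        unfolding W_def by eventually_elim blast
    qed (auto simp: W_def)
  qed
  \<comment> \<open>Nullity of almost every slice gives nullity in the product only for a measurable
    set; hence the statement about \<open>v\<close> is assembled first and \<open>u\<close> is
    restored afterwards.\<close>
  have W_meas: "{z \<in> space (lborel \<Otimes>\<^sub>M lborel). W (fst z) (snd z)} \<in> sets (lborel \<Otimes>\<^sub>M lborel)"
    unfolding W_def D_def indicator_def greaterThanLessThan_iff of_bool_def by measurable
  have "AE x in lborel. AE t in lborel. W x t"
    using \<open>AE t in lborel. AE x in lborel. W x t\<close> by (subst lborel_pair.AE_commute[OF W_meas])
  then have "AE z in lborel \<Otimes>\<^sub>M lborel. W (fst z) (snd z)"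
    by (subst lborel_pair.AE_pair_iff[OF W_meas, symmetric])
  then have "AE z in lborel. W (fst z) (snd z)"
    unfolding lborel_prod .
  with uv have "AE (x, t) in lborel. 0 < t \<and> t < T \<longrightarrow> u x t < \<infinity> \<and>
      u x t = (\<integral>\<^sup>+y. ennreal (G (x - y) t) \<partial>\<mu>) + duhamel G p u 0 x t"
  proof eventually_elim
    case (elim z)
    obtain x t where z: "z = (x, t)"
      by fastforce
    have "u x t < \<infinity> \<and> u x t = (\<integral>\<^sup>+y. ennreal (G (x - y) t) \<partial>\<mu>) + duhamel G p u 0 x t" if t: "0 < t \<and> t < T"
    proof -
      have uv_eq: "u x t = v x t" and W: "W x t"
        using elim t by (auto simp: z)
      have D: "duhamel G p u 0 x t = D 0 x t"
        using t by (intro duhamel_eq) auto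
      have K: "K (x - y) t = G (x - y) t" for y
        using t by (intro K_eq) auto
      show ?thesis
        using W t unfolding W_def uv_eq D K by blast
    qed
    then show ?case
      by (simp only: z prod.case) blast
  qed
  then show ?thesis
    using meas_u by (simp add: is_cauchy_solution_def AE_completion_iff)
qed

end
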